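(* Fix $d\ge3$ and $0<\varepsilon<1/2$, let $q$ be an odd prime power, let $Q$ be a nondegenerate quadratic form on $\mathbb F_q^d$, take the construction in the context, and put $N_q=|\mathfrak A_{d,\gamma}|$. Let $\mathfrak T_q$ be any family of point sets in $\mathbb F_q^d$ satisfying $$\log|\mathfrak T_q|=o(N_q).$$ For all sufficiently large $q$, there is a hypergraph $\mathcal G\subseteq\mathfrak A_{d,\gamma}$ with $$\frac{N_q}3\le|\mathcal G|\le\frac{2N_q}3$$ and $$|P_{\mathcal G}\triangle T|>\varepsilon N_q\qquad(T\in\mathfrak T_q).$$ Every resulting point–sphere system $(P_{\mathcal G},\mathcal S_{\mathrm{rn}})$ has a fixed-scale parameter $K_{\mathcal G}$ bounded above and below by positive constants depending only on $d$, satisfies the point-sensitive lower condition, and lies in the moderate range for large $q$ (with $C_1=1$ if $d\ge4$, and with any $C_1>3/\sqrt2$ if $d=3$). Consequently, any classification of all constant-$K$ fixed-scale systems up to $o(q^d)$ point edits requires $\exp(\Omega_d(q^d))$ distinct templates, even when the sphere family and its lifted rational normal curve are fixed. In particular, no finite, polynomial-size, or more generally subexponential list of individual point-set templates can classify the full fixed-scale class in this edit metric.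
   Context: Put $\langle x,y\rangle_Q=\frac{Q(x+y)-Q(x)-Q(y)}2$ and $S_Q(c,r)=\{x\in\mathbb F_q^d:Q(x-c)=r\}$; spheres are parametrized by pairs $(c,r)\in\mathbb F_q^d\times\mathbb F_q$, and distinct spheres means distinct parameter pairs. For a point set $P$ and a family $\mathcal S$ of distinct spheres, $\sigma(P,\mathcal S)=|\{(p,S)\in P\times\mathcal S:p\in S\}|-|P||\mathcal S|/q$. The fixed-scale parameter $K$ of $(P,\mathcal S)$ (when $\sigma(P,\mathcal S)>0$) is defined by $\sigma(P,\mathcal S)=Kq^{(d-1)/2}\sqrt{|P||\mathcal S|}$; for $(P_{\mathcal G},\mathcal S_{\mathrm{rn}})$ it is denoted $K_{\mathcal G}$. "Constant-$K$" refers to systems whose parameter $K$ is bounded above and below by positive constants as $q\to\infty$. The point-sensitive lower condition is $K^2q^{d-1}|\mathcal S|\ge4|P|$. The system lies in the moderate range with constant $C_1\ge1$ if $\frac{4|P|}{K^2q^{d-1}}\le|\mathcal S|\le C_1Kq^{(d-1)/2}$. The point-edit distance between point sets is the size of their symmetric difference $\triangle$. Construction. Use a Witt decomposition $\mathbb F_q^d=\mathbb F_qe\oplus\mathbb F_qf\oplus V_0$ with $Q(xe+yf+z)=xy+Q_\perp(z)$, where $Q_\perp$ is nondegenerate on the $(d-2)$-dimensional space $V_0$. Fix a basis $u_1,\dots,u_{d-2}$ of $V_0$ and put, for $t\in\mathbb F_q$, $$z_t=\sum_{j=1}^{d-2}t^ju_j,\qquad c_t=t^{d-1}f+z_t,\qquad\gamma=-1-Q(c_1),\qquad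 g(t)=Q(c_t)+t^d+\gamma t^{d-1}.$$ The map $g:\mathbb F_q\to\mathbb F_q$ is not surjective (since $g(0)=g(1)=0$); choose $\kappa\in\mathbb F_q$ with $-\kappa\notin g(\mathbb F_q)$ and put $$b_t=t^d+\gamma t^{d-1}+\kappa,\qquad r_t=Q(c_t)+b_t,\qquad S_t=S_Q(c_t,r_t),\qquad\mathcal S_{\mathrm{rn}}=\{S_t:t\in\mathbb F_q\}.$$ All radii $r_t$ are nonzero. With the lift $\Phi(S_Q(c,r))=(2c,r-Q(c))\in\mathbb F_q^{d+1}$, the lifted parameters $\Phi(S_t)$ are affinely equivalent to $t\mapsto(t,t^2,\dots,t^d)$; this is the lifted rational normal curve of $\mathcal S_{\mathrm{rn}}$. The map $$\Psi(xe+yf+z)(T)=T^d+(x+\gamma)T^{d-1}+\sum_{j=1}^{d-2}2\langle z,u_j\rangle_QT^j+\kappa-Q(xe+yf+z)$$ is a bijection from $\{xe+yf+z:x\in\mathbb F_q^\times,\ y\in\mathbb F_q,\ z\in V_0\}$ onto the set of monic degree-$d$ polynomials over $\mathbb F_q$ whose $T^{d-1}$-coefficient is not $\gamma$. Let $$\mathfrak A_{d,\gamma}=\Bigl\{A\subseteq\mathbb F_q:|A|=d,\ -\sum_{a\in A}a\ne\gamma\Bigr\}.$$ For $A\in\mathfrak A_{d,\gamma}$ let $p_A$ be the point with $\Psi(p_A)=\prod_{a\in A}(T-a)$, and for a ($d$-uniform) hypergraph $\mathcal G\subseteq\mathfrak A_{d,\gamma}$ on the label set $\mathbb F_q$ put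 $P_{\mathcal G}=\{p_A:A\in\mathcal G\}$. *)

theory Defs
  imports "HOL-Algebra.UnivPoly" "HOL-Algebra.Coset" "HOL-Library.Landau_Symbols"
begin

text \<open>
  The order $q$ of the finite field varies inside the statement, so fields are
  \<^locale>\<open>field\<close> structures carried by subsets of a fixed type; with a countably infinite
  type such as \<^typ>\<open>nat\<close> every finite field occurs up to isomorphism.
\<close>

definition coord_space :: "nat \<Rightarrow> ('a, 'm) ring_scheme \<Rightarrow> ('a, nat \<Rightarrow> 'a) module" where
  "coord_space d R = \<lparr>
     carrier = {..<d} \<rightarrow>\<^sub>E carrier R,
     mult = (\<lambda>v w. \<lambda>i\<in>{..<d}. v i \<otimes>\<^bsub>R\<^esub> w i),
     one = (\<lambda>i\<in>{..<d}. \<one>\<^bsub>R\<^esub>),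
     zero = (\<lambda>i\<in>{..<d}. \<zero>\<^bsub>R\<^esub>),
     add = (\<lambda>v w. \<lambda>i\<in>{..<d}. v i \<oplus>\<^bsub>R\<^esub> w i),
     smult = (\<lambda>a v. \<lambda>i\<in>{..<d}. a \<otimes>\<^bsub>R\<^esub> v i)\<rparr>"

text \<open>
  The data from which the construction is made: the field, the form $Q$, the hyperbolic pair
  $e, f$, the complement $V_0$, its basis $u_1, \dots, u_{d-2}$ (values of \<open>wbasis\<close> outside
  these indices are irrelevant) and the constant $\kappa$.
\<close>

record 'a rn_data = "'a ring" +
  qform :: "(nat \<Rightarrow> 'a) \<Rightarrow> 'a"
  hyp_e :: "nat \<Rightarrow> 'a"
  hyp_f :: "nat \<Rightarrow> 'a"
  wperp :: "(nat \<Rightarrow> 'a) set"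
  wbasis :: "nat \<Rightarrow> nat \<Rightarrow> 'a"
  kappa :: 'a

context
  fixes d :: nat and C :: "'a rn_data" (structure)
begin

abbreviation points :: "(nat \<Rightarrow> 'a) set" where
  "points \<equiv> carrier (coord_space d C)"

definition wpoint :: "'a \<Rightarrow> 'a \<Rightarrow> (nat \<Rightarrow> 'a) \<Rightarrow> nat \<Rightarrow> 'a" where
  "wpoint x y z = x \<odot>\<^bsub>coord_space d C\<^esub> hyp_e C \<oplus>\<^bsub>coord_space d C\<^esub>
     y \<odot>\<^bsub>coord_space d C\<^esub> hyp_f C \<oplus>\<^bsub>coord_space d C\<^esub> z"

definition qinner :: "(nat \<Rightarrow> 'a) \<Rightarrow> (nat \<Rightarrow> 'a) \<Rightarrow> 'a" where
  "qinner x y =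
     (qform C (x \<oplus>\<^bsub>coord_space d C\<^esub> y) \<ominus> qform C x \<ominus> qform C y) \<otimes> inv (\<one> \<oplus> \<one>)"

definition quadratic_form :: bool where
  "quadratic_form \<longleftrightarrow>
     qform C \<in> points \<rightarrow> carrier C \<and>
     (\<forall>a\<in>carrier C. \<forall>x\<in>points.
        qform C (a \<odot>\<^bsub>coord_space d C\<^esub> x) = a [^] (2::nat) \<otimes> qform C x) \<and>
     (\<forall>x\<in>points. \<forall>y\<in>points. \<forall>z\<in>points.
        qinner (x \<oplus>\<^bsub>coord_space d C\<^esub> y) z = qinner x z \<oplus> qinner y z) \<and>
     (\<forall>a\<in>carrier C. \<forall>x\<in>points. \<forall>z\<in>points.
        qinner (a \<odot>\<^bsub>coord_space d C\<^esub> x) z = a \<otimes> qinner x z)"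

definition nondegenerate_on :: "(nat \<Rightarrow> 'a) set \<Rightarrow> bool" where
  "nondegenerate_on W \<longleftrightarrow>
     (\<forall>x\<in>W. (\<forall>y\<in>W. qinner x y = \<zero>) \<longrightarrow> x = \<zero>\<^bsub>coord_space d C\<^esub>)"

text \<open>The form $Q_\perp$ is the restriction of $Q$ to $V_0$.\<close>

definition witt_decomposition :: bool where
  "witt_decomposition \<longleftrightarrow>
     hyp_e C \<in> points \<and> hyp_f C \<in> points \<and> submodule (wperp C) C (coord_space d C) \<and>
     bij_betw (\<lambda>(x, y, z). wpoint x y z) (carrier C \<times> carrier C \<times> wperp C) points \<and>
     (\<forall>x\<in>carrier C. \<forall>y\<in>carrier C. \<forall>z\<in>wperp C.
        qform C (wpoint x y z) = x \<otimes> y \<oplus> qform C z) \<and>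
     nondegenerate_on (wperp C)"

definition wperp_basis :: bool where
  "wperp_basis \<longleftrightarrow>
     (\<forall>j\<in>{1..d-2}. wbasis C j \<in> wperp C) \<and>
     bij_betw
       (\<lambda>a. \<Oplus>\<^bsub>coord_space d C\<^esub>j\<in>{1..d-2}. a j \<odot>\<^bsub>coord_space d C\<^esub> wbasis C j)
       ({1..d-2} \<rightarrow>\<^sub>E carrier C) (wperp C)"

abbreviation spheres :: "((nat \<Rightarrow> 'a) \<times> 'a) set" where
  "spheres \<equiv> points \<times> carrier C"

definition sphere_pts :: "(nat \<Rightarrow> 'a) \<times> 'a \<Rightarrow> (nat \<Rightarrow> 'a) set" where
  "sphere_pts = (\<lambda>(c, r). {x\<in>points. qform C (x \<ominus>\<^bsub>coord_space d C\<^esub> c) = r})"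

definition incidence_excess ::
    "(nat \<Rightarrow> 'a) set \<Rightarrow> ((nat \<Rightarrow> 'a) \<times> 'a) set \<Rightarrow> real" where
  "incidence_excess P S =
     real (card {(p, s)\<in>P \<times> S. p \<in> sphere_pts s}) -
     real (card P) * real (card S) / real (order C)"

text \<open>As the excess is positive, $P$ and $S$ are nonempty and \<open>K\<close> is unique.\<close>

definition fixed_scale_param ::
    "(nat \<Rightarrow> 'a) set \<Rightarrow> ((nat \<Rightarrow> 'a) \<times> 'a) set \<Rightarrow> real \<Rightarrow> bool" where
  "fixed_scale_param P S K \<longleftrightarrow>
     incidence_excess P S > 0 \<and>
     incidence_excess P S =
       K * real (order C) powr ((real d - 1) / 2) * sqrt (real (card P) * real (card S))"

definition point_sensitive_lower ::
    "(nat \<Rightarrow> 'a) set \<Rightarrow> ((nat \<Rightarrow> 'a) \<times> 'a) set \<Rightarrow> real \<Rightarrow> bool" where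
  "point_sensitive_lower P S K \<longleftrightarrow>
     K\<^sup>2 * real (order C) ^ (d-1) * real (card S) \<ge> 4 * real (card P)"

definition moderate_range ::
    "real \<Rightarrow> (nat \<Rightarrow> 'a) set \<Rightarrow> ((nat \<Rightarrow> 'a) \<times> 'a) set \<Rightarrow> real \<Rightarrow> bool" where
  "moderate_range C1 P S K \<longleftrightarrow>
     C1 \<ge> 1 \<and>
     4 * real (card P) / (K\<^sup>2 * real (order C) ^ (d-1)) \<le> real (card S) \<and>
     real (card S) \<le> C1 * K * real (order C) powr ((real d - 1) / 2)"

definition rn_z :: "'a \<Rightarrow> nat \<Rightarrow> 'a" where
  "rn_z t = (\<Oplus>\<^bsub>coord_space d C\<^esub>j\<in>{1..d-2}. (t [^] j) \<odot>\<^bsub>coord_space d C\<^esub> wbasis C j)"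

definition rn_center :: "'a \<Rightarrow> nat \<Rightarrow> 'a" where
  "rn_center t = (t [^] (d-1)) \<odot>\<^bsub>coord_space d C\<^esub> hyp_f C \<oplus>\<^bsub>coord_space d C\<^esub> rn_z t"

definition rn_gamma :: 'a where
  "rn_gamma = \<ominus> \<one> \<ominus> qform C (rn_center \<one>)"

definition rn_g :: "'a \<Rightarrow> 'a" where
  "rn_g t = qform C (rn_center t) \<oplus> t [^] d \<oplus> rn_gamma \<otimes> t [^] (d-1)"

definition rn_b :: "'a \<Rightarrow> 'a" where
  "rn_b t = t [^] d \<oplus> rn_gamma \<otimes> t [^] (d-1) \<oplus> kappa C"

definition rn_radius :: "'a \<Rightarrow> 'a" where
  "rn_radius t = qform C (rn_center t) \<oplus> rn_b t"

definition rn_spheres :: "((nat \<Rightarrow> 'a) \<times> 'a) set" where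
  "rn_spheres = (\<lambda>t. (rn_center t, rn_radius t)) ` carrier C"

definition rn_construction :: bool where
  "rn_construction \<longleftrightarrow>
     field C \<and> finite (carrier C) \<and> odd (order C) \<and>
     quadratic_form \<and> nondegenerate_on points \<and>
     witt_decomposition \<and> wperp_basis \<and>
     kappa C \<in> carrier C \<and> \<ominus> kappa C \<notin> rn_g ` carrier C"

text \<open>\<open>rn_Psi x y z\<close> is $\Psi(xe+yf+z)$.\<close>

definition rn_Psi :: "'a \<Rightarrow> 'a \<Rightarrow> (nat \<Rightarrow> 'a) \<Rightarrow> nat \<Rightarrow> 'a" where
  "rn_Psi x y z =
     monom (UP C) \<one> d \<oplus>\<^bsub>UP C\<^esub>
     monom (UP C) (x \<oplus> rn_gamma) (d-1) \<oplus>\<^bsub>UP C\<^esub>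
     (\<Oplus>\<^bsub>UP C\<^esub>j\<in>{1..d-2}. monom (UP C) ((\<one> \<oplus> \<one>) \<otimes> qinner z (wbasis C j)) j) \<oplus>\<^bsub>UP C\<^esub>
     monom (UP C) (kappa C \<ominus> qform C (wpoint x y z)) 0"

definition admissible :: "'a set set" where
  "admissible = {A. A \<subseteq> carrier C \<and> card A = d \<and> \<ominus> (\<Oplus>a\<in>A. a) \<noteq> rn_gamma}"

definition rn_point :: "'a set \<Rightarrow> nat \<Rightarrow> 'a" where
  "rn_point A = (THE p. \<exists>x\<in>carrier C - {\<zero>}. \<exists>y\<in>carrier C. \<exists>z\<in>wperp C.
     p = wpoint x y z \<and>
     rn_Psi x y z =
       (\<Otimes>\<^bsub>UP C\<^esub>a\<in>A. monom (UP C) \<one> 1 \<ominus>\<^bsub>UP C\<^esub> monom (UP C) a 0))"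

definition rn_points :: "'a set set \<Rightarrow> (nat \<Rightarrow> 'a) set" where
  "rn_points G = rn_point ` G"

definition middle_hypergraph :: "'a set set \<Rightarrow> bool" where
  "middle_hypergraph G \<longleftrightarrow>
     G \<subseteq> admissible \<and>
     real (card admissible) / 3 \<le> real (card G) \<and>
     real (card G) \<le> 2 * real (card admissible) / 3"

end

text \<open>
  Limits $q \to \infty$ are taken along arbitrary sequences of constructions; enumerating the odd
  prime powers gives the case of one construction for each $q$.
\<close>

definition rn_sequence :: "nat \<Rightarrow> (nat \<Rightarrow> 'a rn_data) \<Rightarrow> bool" where
  "rn_sequence d D \<longleftrightarrow>
     (\<forall>n. rn_construction d (D n)) \<and> filterlim (\<lambda>n. order (D n)) at_top sequentially"

definition template_family ::
    "nat \<Rightarrow> (nat \<Rightarrow> 'a rn_data) \<Rightarrow> (nat \<Rightarrow> (nat \<Rightarrow> 'a) set set) \<Rightarrow> bool" where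
  "template_family d D \<T> \<longleftrightarrow> (\<forall>n. \<T> n \<subseteq> Pow (points d (D n)))"

definition constant_K ::
    "nat \<Rightarrow> (nat \<Rightarrow> 'a rn_data) \<Rightarrow> (nat \<Rightarrow> (nat \<Rightarrow> 'a) set) \<Rightarrow>
     (nat \<Rightarrow> ((nat \<Rightarrow> 'a) \<times> 'a) set) \<Rightarrow> bool" where
  "constant_K d D P S \<longleftrightarrow>
     (\<forall>n. P n \<subseteq> points d (D n) \<and> S n \<subseteq> spheres d (D n)) \<and>
     (\<exists>k1>0. \<exists>k2>0. \<forall>\<^sub>F n in sequentially.
        \<exists>K. fixed_scale_param d (D n) (P n) (S n) K \<and> k1 \<le> K \<and> K \<le> k2)"

text \<open>
  \<open>\<T>\<close> classifies the constant-$K$ systems with sphere families from \<open>\<S>\<close> up to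
  $o(q^d)$ point edits. The implied rate may depend on the system.
\<close>

definition classifies ::
    "nat \<Rightarrow> (nat \<Rightarrow> 'a rn_data) \<Rightarrow> (nat \<Rightarrow> ((nat \<Rightarrow> 'a) \<times> 'a) set set) \<Rightarrow>
     (nat \<Rightarrow> (nat \<Rightarrow> 'a) set set) \<Rightarrow> bool" where
  "classifies d D \<S> \<T> \<longleftrightarrow>
     (\<forall>P S. constant_K d D P S \<and> (\<forall>n. S n \<in> \<S> n) \<longrightarrow>
        (\<exists>\<tau>. (\<forall>\<^sub>F n in sequentially. \<tau> n \<in> \<T> n) \<and>
             (\<lambda>n. real (card (sym_diff (P n) (\<tau> n)))) \<in> o(\<lambda>n. real (order (D n)) ^ d)))"

definition classifies_all ::
    "nat \<Rightarrow> (nat \<Rightarrow> 'a rn_data) \<Rightarrow> (nat \<Rightarrow> (nat \<Rightarrow> 'a) set set) \<Rightarrow> bool" where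
  "classifies_all d D = classifies d D (\<lambda>n. Pow (spheres d (D n)))"

definition classifies_rn ::
    "nat \<Rightarrow> (nat \<Rightarrow> 'a rn_data) \<Rightarrow> (nat \<Rightarrow> (nat \<Rightarrow> 'a) set set) \<Rightarrow> bool" where
  "classifies_rn d D = classifies d D (\<lambda>n. {rn_spheres d (D n)})"

end

theory Submission
  imports Defs "HOL-Algebra.Multiplicative_Group"
begin

text \<open>
  The point $p_A$ lies on $S_t$ exactly when $t$ is a root of $\Psi(p_A) = \prod_{a \in A}(T - a)$,
  that is, when $t \in A$. So each of the $|\mathcal G|$ points lies on exactly $d$ of the $q$ spheres,
  the excess is $(d-1)|\mathcal G|$, and $K = (d-1)\sqrt{|\mathcal G|/q^d}$. As $N_q \sim q^d/d!$, this
  is bounded above and below when $\mathcal G$ is in the middle range, and for $d = 3$ it is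
  asymptotically at least $\sqrt 2/3$.

  The map $\mathcal G \mapsto P_{\mathcal G}$ is injective, so the number of hypergraphs within
  $\varepsilon N$ edits of one template is at most
  $\sum_{k \le \varepsilon N} \binom Nk \le x^{-\varepsilon N}(1+x)^N$ for $0 < x \le 1$. For
  $\varepsilon < 1/2$ some $x$ makes this exponentially smaller than $2^N$, so subexponentially many
  templates miss some $\mathcal G$.
\<close>

section \<open>Subsets far from a family\<close>

text \<open>The shape of Psi comes from expanding the quadratic form: Psi(p)(t) = r_t - Q(p - c_t),
  where Q(c_t) cancels. The equation of S_t thus becomes a monic equation of degree d in t. Of the
  bijectivity of Psi only the unique solvability of Psi(p) = prod (T - a) enters. Comparing
  coefficients gives x, then z, then the product xy; the excluded T^(d-1)-coefficient gamma is
  exactly the case x = 0, where y could not be recovered. Excluding it costs at most binom(q, d-1)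
  sets, which is of lower order than q^d.

  The obstacle in the classification statement is its quantifiers. A classification has to match
  each sequence of systems only eventually, at a rate that may depend on the sequence. Far
  hypergraphs at separate values of q must therefore be assembled into one constant-K sequence that
  is far from all templates at every large index with few templates. This is why rates and
  thresholds are made uniform over all constructions.\<close>

lemma sum_Pow_power_card:
  fixes x :: "'b::comm_semiring_1"
  assumes "finite U"
  shows "(\<Sum>G\<in>Pow U. x ^ card G) = (1 + x) ^ card U"
  using assms
proof (induction U rule: finite_induct)
  case (insert u U)
  have "(\<Sum>G\<in>Pow (insert u U). x ^ card G) =
      (\<Sum>G\<in>Pow U. x ^ card G) + (\<Sum>G\<in>insert u ` Pow U. x ^ card G)"
    using insert.hyps unfolding Pow_insert by (intro sum.union_disjoint) auto
  also have "(\<Sum>G\<in>insert u ` Pow U. x ^ card G) = (\<Sum>G\<in>Pow U. x ^ card (insert u G))"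
    using insert.hyps by (subst sum.reindex) (auto simp: inj_on_def)
  also have "\<dots> = (\<Sum>G\<in>Pow U. x * x ^ card G)"
  proof (rule sum.cong)
    fix G assume "G \<in> Pow U"
    then have "finite G" "u \<notin> G" using insert.hyps finite_subset by auto
    then show "x ^ card (insert u G) = x * x ^ card G" by simp
  qed simp
  finally show ?case
    using insert by (simp add: sum_distrib_left[symmetric] algebra_simps)
qed simp

text \<open>Exponential-moment bound: since x \<le> 1, every counted \<open>G\<close> has weight
  x^|G| \<ge> x^r, and the weights over all of \<open>Pow U\<close> sum to (1 + x)^|U|.\<close>

lemma card_small_subsets:
  fixes x r :: real
  assumes "finite U" "0 < x" "x \<le> 1"
  shows "real (card {G\<in>Pow U. real (card G) \<le> r}) * x powr r \<le> (1 + x) ^ card U"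
proof -
  have "real (card {G\<in>Pow U. real (card G) \<le> r}) * x powr r =
      (\<Sum>G\<in>{G\<in>Pow U. real (card G) \<le> r}. x powr r)"
    by simp
  also have "\<dots> \<le> (\<Sum>G\<in>{G\<in>Pow U. real (card G) \<le> r}. x ^ card G)"
    using assms by (intro sum_mono) (auto simp: powr_realpow[symmetric] intro!: powr_mono')
  also have "\<dots> \<le> (\<Sum>G\<in>Pow U. x ^ card G)"
    using assms by (intro sum_mono2) auto
  finally show ?thesis by (simp add: sum_Pow_power_card assms(1))
qed

text \<open>Symmetric difference with \<open>T \<inter> U\<close> is an injection of
  \<open>Pow U\<close> into itself. It carries the ball around \<open>T\<close> into the ball around
  the empty set, because the part of \<open>T\<close> outside \<open>U\<close> only adds to the
  distance.\<close>

lemma card_edit_ball: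
  assumes "finite U" "finite T"
  shows "card {G\<in>Pow U. real (card (sym_diff G T)) \<le> r} \<le> card {G\<in>Pow U. real (card G) \<le> r}"
proof (rule card_inj_on_le)
  show "inj_on (\<lambda>G. sym_diff G (T \<inter> U)) {G\<in>Pow U. real (card (sym_diff G T)) \<le> r}"
    by (rule inj_onI) blast
  show "(\<lambda>G. sym_diff G (T \<inter> U)) ` {G\<in>Pow U. real (card (sym_diff G T)) \<le> r}
      \<subseteq> {G\<in>Pow U. real (card G) \<le> r}"
  proof (rule image_subsetI)
    fix G assume G: "G \<in> {G\<in>Pow U. real (card (sym_diff G T)) \<le> r}"
    then have "card (sym_diff G (T \<inter> U)) \<le> card (sym_diff G T)"
      using assms finite_subset by (intro card_mono) auto
    then show "sym_diff G (T \<inter> U) \<in> {G\<in>Pow U. real (card G) \<le> r}"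
      using G by auto
  qed
qed (use assms in auto)

text \<open>Union bound: otherwise the edit balls around the templates would cover
  \<open>Pow U\<close>, yet each holds at most a fraction exp(-\<delta>|U|) of it. The rate \<delta>
  is chosen before \<open>U\<close>, which later permits one rate for all fields.\<close>

lemma ex_far_subset:
  fixes \<epsilon> :: real
  assumes "\<epsilon> < 1/2"
  shows "\<exists>\<delta>>0. \<forall>(U :: 'b set) \<T>. finite U \<and> finite \<T> \<and> (\<forall>T\<in>\<T>. finite T) \<and>
    real (card \<T>) < exp (\<delta> * real (card U)) \<longrightarrow>
    (\<exists>G\<subseteq>U. \<forall>T\<in>\<T>. \<epsilon> * real (card U) < real (card (sym_diff G T)))"
proof -
  \<comment> \<open>Both 2 x^\<epsilon> and 1 + x equal 2 at x = 1, and their difference has slope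
    2\<epsilon> - 1 < 0 there. Just to the left of 1 the first therefore exceeds the second.\<close>
  have "((\<lambda>x. 2 * x powr \<epsilon> - (1 + x)) has_real_derivative (2 * \<epsilon> - 1)) (at 1)"
    by (auto intro!: derivative_eq_intros)
  from DERIV_neg_dec_left[OF this] assms obtain e where e: "0 < e"
    "\<And>h. 0 < h \<Longrightarrow> h < e \<Longrightarrow> 2 * 1 powr \<epsilon> - (1 + 1) < 2 * (1 - h) powr \<epsilon> - (1 + (1 - h))"
    by auto
  \<comment> \<open>The cap 1/2 keeps \<open>x\<close> positive; halving \<open>e\<close> stays
    strictly inside the interval of validity.\<close>
  define x where "x = 1 - min (e/2) (1/2)"
  have x: "0 < x" "x < 1" "1 + x < 2 * x powr \<epsilon>"
    using e(1) e(2)[of "min (e/2) (1/2)"] by (auto simp: x_def)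
  \<comment> \<open>The logarithmic gain, per element of \<open>U\<close>, of 2^|U| over the bound
    for one ball.\<close>
  define \<delta> where "\<delta> = ln (2 * x powr \<epsilon> / (1 + x))"
  have "0 < \<delta>" using x by (simp add: \<delta>_def)
  moreover have "\<exists>G\<subseteq>U. \<forall>T\<in>\<T>. \<epsilon> * real (card U) < real (card (sym_diff G T))"
    if U: "finite U" and T: "finite \<T>" "\<forall>T\<in>\<T>. finite T"
      and small: "real (card \<T>) < exp (\<delta> * real (card U))" for U :: "'b set" and \<T>
  proof (rule ccontr)
    define N where "N = card U"
    define b where "b = real (card {G\<in>Pow U. real (card G) \<le> \<epsilon> * real N})"
    assume "\<not> ?thesis"
    then have "Pow U \<subseteq> (\<Union>T\<in>\<T>. {G\<in>Pow U. real (card (sym_diff G T)) \<le> \<epsilon> * real N})"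
      unfolding N_def by (simp add: not_less subset_iff Bex_def) blast
    then have "card (Pow U) \<le> card (\<Union>T\<in>\<T>. {G\<in>Pow U. real (card (sym_diff G T)) \<le> \<epsilon> * real N})"
      using U T by (intro card_mono) auto
    also have "\<dots> \<le> (\<Sum>T\<in>\<T>. card {G\<in>Pow U. real (card (sym_diff G T)) \<le> \<epsilon> * real N})"
      using T(1) by (rule card_UN_le)
    also have "\<dots> \<le> (\<Sum>T\<in>\<T>. card {G\<in>Pow U. real (card G) \<le> \<epsilon> * real N})"
      using U T by (intro sum_mono card_edit_ball) auto
    finally have "2 ^ N \<le> card \<T> * card {G\<in>Pow U. real (card G) \<le> \<epsilon> * real N}"
      by (simp add: card_Pow U N_def)
    then have "real (2 ^ N) \<le> real (card \<T> * card {G\<in>Pow U. real (card G) \<le> \<epsilon> * real N})"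
      by (rule of_nat_mono)
    then have count: "2 ^ N \<le> real (card \<T>) * b"
      by (simp add: b_def)
    have x_pow: "x powr (\<epsilon> * real N) = (x powr \<epsilon>) ^ N"
      using x by (simp add: powr_powr[symmetric] powr_realpow)
    have "2 ^ N * (x powr \<epsilon>) ^ N \<le> real (card \<T>) * (b * x powr (\<epsilon> * real N))"
      using count by (simp add: x_pow mult.assoc[symmetric] mult_right_mono)
    also have "\<dots> \<le> real (card \<T>) * (1 + x) ^ N"
      using card_small_subsets[OF U, of x "\<epsilon> * real N"] x
      by (intro mult_left_mono) (auto simp: b_def N_def)
    finally have "(2 * x powr \<epsilon> / (1 + x)) ^ N \<le> real (card \<T>)"
      using x by (simp add: power_divide power_mult_distrib divide_simps)
    also have "(2 * x powr \<epsilon> / (1 + x)) ^ N = exp (\<delta> * real N)"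
      using x by (simp add: \<delta>_def exp_of_nat2_mult)
    finally show False using small by (simp add: N_def)
  qed
  ultimately show ?thesis by blast
qed

text \<open>
  Adding \<open>{}\<close> and \<open>U\<close> to the family to be avoided forces the size of \<open>G\<close> into the middle third.
\<close>

lemma ex_far_middle_subset:
  fixes \<epsilon> :: real
  assumes "\<epsilon> < 1/2"
  shows "\<exists>\<delta>>0. \<exists>N\<^sub>0. \<forall>(U :: 'b set) \<T>.
    finite U \<and> finite \<T> \<and> (\<forall>T\<in>\<T>. finite T) \<and> N\<^sub>0 \<le> card U \<and>
    real (card \<T>) \<le> exp (\<delta> * real (card U)) \<longrightarrow>
    (\<exists>G\<subseteq>U. real (card U) / 3 \<le> real (card G) \<and> real (card G) \<le> 2 * real (card U) / 3 \<and>
      (\<forall>T\<in>\<T>. \<epsilon> * real (card U) < real (card (sym_diff G T))))"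
proof -
  \<comment> \<open>The two added sets call for a radius of at least 1/3, which is still below the
    critical value 1/2.\<close>
  have "max \<epsilon> (1/3) < 1/2" using assms by simp
  from ex_far_subset[OF this] obtain \<delta> where \<delta>: "\<delta> > 0"
    "\<And>(U :: 'b set) \<T>. \<lbrakk>finite U; finite \<T>; \<forall>T\<in>\<T>. finite T; real (card \<T>) < exp (\<delta> * real (card U))\<rbrakk> \<Longrightarrow>
      \<exists>G\<subseteq>U. \<forall>T\<in>\<T>. max \<epsilon> (1/3) * real (card U) < real (card (sym_diff G T))"
    by metis
  obtain N\<^sub>0 :: nat where "2 * ln 2 / \<delta> < real N\<^sub>0" using reals_Archimedean2 by blast
  \<comment> \<open>Halving the rate pays for the two added sets: for y = exp(\<delta>n/2) > 2 one
    has y + 2 < 2y < y^2.\<close>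
  then have "2 < exp (\<delta> / 2 * real n)" if "n \<ge> N\<^sub>0" for n
    using \<delta>(1) that less_le_trans[of "2 * ln 2 / \<delta>" "real N\<^sub>0" "real n"]
    by (subst ln_less_cancel_iff[symmetric]) (auto simp: field_simps)
  then have N\<^sub>0: "exp (\<delta> / 2 * real n) + 2 < exp (\<delta> * real n)" if "n \<ge> N\<^sub>0" for n
    using that mult_strict_right_mono[of 2 "exp (\<delta> / 2 * real n)" "exp (\<delta> / 2 * real n)"]
    by (fastforce simp: exp_add[symmetric])
  show ?thesis
  proof (rule exI[of _ "\<delta>/2"], intro conjI exI[of _ N\<^sub>0] allI impI)
    fix U :: "'b set" and \<T> :: "'b set set"
    assume "finite U \<and> finite \<T> \<and> (\<forall>T\<in>\<T>. finite T) \<and> N\<^sub>0 \<le> card U \<and>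
      real (card \<T>) \<le> exp (\<delta> / 2 * real (card U))"
    then have fin: "finite U" "finite \<T>" "\<forall>T\<in>\<T>. finite T" and "N\<^sub>0 \<le> card U"
      and small: "real (card \<T>) \<le> exp (\<delta> / 2 * real (card U))" by auto
    have "card (insert {} (insert U \<T>)) \<le> card \<T> + 2"
      using card_insert_le_m1[of "Suc (Suc (card \<T>))"] by (simp add: card_insert_if fin)
    then have "real (card (insert {} (insert U \<T>))) < exp (\<delta> * real (card U))"
      using N\<^sub>0[OF \<open>N\<^sub>0 \<le> card U\<close>] small by linarith
    then obtain G where G: "G \<subseteq> U"
      "\<forall>T\<in>insert {} (insert U \<T>). max \<epsilon> (1/3) * real (card U) < real (card (sym_diff G T))"
      using \<delta>(2)[of U "insert {} (insert U \<T>)"] fin by auto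
    have far: "\<epsilon> * real (card U) < real (card (sym_diff G T))"
        "1/3 * real (card U) < real (card (sym_diff G T))" if "T \<in> insert {} (insert U \<T>)" for T
    proof -
      have "\<epsilon> * real (card U) \<le> max \<epsilon> (1/3) * real (card U)"
        "1/3 * real (card U) \<le> max \<epsilon> (1/3) * real (card U)"
        by (intro mult_right_mono; simp)+
      then show "\<epsilon> * real (card U) < real (card (sym_diff G T))"
        "1/3 * real (card U) < real (card (sym_diff G T))" using G(2) that by fastforce+
    qed
    have "sym_diff G U = U - G" using G(1) by auto
    then have "card (sym_diff G U) = card U - card G"
      using G(1) fin(1) by (simp add: card_Diff_subset finite_subset)
    moreover have "card G \<le> card U" using G(1) fin(1) by (rule card_mono[rotated])
    ultimately show "\<exists>G\<subseteq>U. real (card U) / 3 \<le> real (card G) \<and> real (card G) \<le> 2 * real (card U) / 3 \<and>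
      (\<forall>T\<in>\<T>. \<epsilon> * real (card U) < real (card (sym_diff G T)))"
      using G(1) far(2)[of "{}"] far(2)[of U] far(1) by (intro exI[of _ G]) auto
  qed (use \<delta>(1) in auto)
qed

section \<open>Growth of binomial coefficients\<close>

lemma binomial_over_power_tendsto:
  "(\<lambda>q. real (q choose k) / real q ^ k) \<longlonglongrightarrow> 1 / fact k"
proof (induction k)
  case 0
  then show ?case by simp
next
  case (Suc k)
  have "(\<lambda>q. (real q - real k) / real q) \<longlonglongrightarrow> 1"
  proof (rule Lim_transform_eventually)
    show "(\<lambda>q. 1 - real k * (1 / real q)) \<longlonglongrightarrow> 1"
      using tendsto_diff[OF tendsto_const[of 1] tendsto_mult[OF tendsto_const[of "real k"] lim_1_over_n]]
      by simp
    show "\<forall>\<^sub>F q in sequentially. 1 - real k * (1 / real q) = (real q - real k) / real q"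
      using eventually_gt_at_top[of 0] by eventually_elim (simp add: field_simps)
  qed
  then have "(\<lambda>q. real (q choose k) / real q ^ k * ((real q - real k) / real q) / real (Suc k)) \<longlonglongrightarrow>
      1 / fact k * 1 / real (Suc k)"
    by (intro tendsto_intros Suc.IH) auto
  \<comment> \<open>Passing from k to k + 1 multiplies the ratio by (q - k) / (q (k + 1)), by
    binomial absorption. For q < k both binomial coefficients vanish.\<close>
  moreover have "real (q choose k) / real q ^ k * ((real q - real k) / real q) / real (Suc k) =
      real (q choose Suc k) / real q ^ Suc k" for q
  proof (cases "k \<le> q")
    case True
    have "Suc k * (q choose Suc k) = (q - k) * (q choose k)"
      by (simp only: binomial_absorption binomial_absorb_comp)
    then have "real (Suc k) * real (q choose Suc k) = (real q - real k) * real (q choose k)"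
      using True by (metis of_nat_diff of_nat_mult)
    then have "real (q choose Suc k) = real (q choose k) * (real q - real k) / real (Suc k)"
      by (simp add: field_simps del: of_nat_Suc)
    then show ?thesis by (simp add: mult.commute)
  qed (simp add: binomial_eq_0)
  ultimately show ?case by (simp add: fact_Suc mult.commute)
qed

text \<open>With d = k + 1 the numerator is the lower bound for the number of admissible sets. The
  subtracted binomial has degree k in q and disappears after division by q^(k+1).\<close>

lemma binomial_difference_tendsto:
  "(\<lambda>q. (real (q choose Suc k) - real (q choose k)) / real q ^ Suc k) \<longlonglongrightarrow> 1 / fact (Suc k)"
proof -
  have "(\<lambda>q. real (q choose Suc k) / real q ^ Suc k - real (q choose k) / real q ^ k * (1 / real q))
      \<longlonglongrightarrow> 1 / fact (Suc k) - 1 / fact k * 0"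
    by (intro tendsto_diff tendsto_mult binomial_over_power_tendsto lim_1_over_n)
  then show ?thesis by (simp add: diff_divide_distrib mult.commute)
qed

section \<open>Products of linear factors\<close>

lemma (in cring) coord_space_module: "Module.module R (coord_space n R)"
proof (rule Module.moduleI)
  show "abelian_group (coord_space n R)"
  proof (rule abelian_groupI)
    fix v assume v: "v \<in> carrier (coord_space n R)"
    show "\<exists>w\<in>carrier (coord_space n R). w \<oplus>\<^bsub>coord_space n R\<^esub> v = \<zero>\<^bsub>coord_space n R\<^esub>"
      by (rule bexI[of _ "\<lambda>i\<in>{..<n}. \<ominus> v i"])
         (use v in \<open>auto simp: coord_space_def PiE_iff l_neg intro!: restrict_ext\<close>)
  qed (auto simp: coord_space_def PiE_iff extensional_def restrict_def fun_eq_iff a_assoc a_comm a_lcomm)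
qed (auto simp: coord_space_def PiE_iff extensional_def restrict_def fun_eq_iff cring_axioms
       l_distr r_distr m_assoc)

abbreviation (in UP) linear_factor where
  "linear_factor a \<equiv> monom P \<one> 1 \<ominus>\<^bsub>P\<^esub> monom P a 0"

lemma (in UP_cring) coeff_linear_factor_mult:
  assumes "a \<in> carrier R" "p \<in> carrier P"
  shows "coeff P (linear_factor a \<otimes>\<^bsub>P\<^esub> p) (Suc n) = coeff P p n \<ominus> a \<otimes> coeff P p (Suc n)"
proof -
  have "linear_factor a \<otimes>\<^bsub>P\<^esub> p = monom P \<one> 1 \<otimes>\<^bsub>P\<^esub> p \<ominus>\<^bsub>P\<^esub> monom P a 0 \<otimes>\<^bsub>P\<^esub> p"
    using assms by (simp add: a_minus_def P.l_distr P.l_minus del: monom_one)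
  then show ?thesis
    using assms coeff_monom_mult[of \<one> p 1 n] coeff_monom_mult[of a p 0 "Suc n"]
    by simp
qed

lemma (in UP_cring) prod_linear_closed:
  "A \<subseteq> carrier R \<Longrightarrow> (\<Otimes>\<^bsub>P\<^esub>a\<in>A. linear_factor a) \<in> carrier P"
  by (intro P.finprod_closed) auto

text \<open>The three facts need one joint induction: the subleading coefficient of the enlarged
  product uses the leading coefficient of the smaller one, which in turn rests on the vanishing
  above it.\<close>

lemma (in UP_cring) coeff_prod_linear:
  assumes "finite A" "A \<subseteq> carrier R"
  shows coeff_prod_linear_top: "coeff P (\<Otimes>\<^bsub>P\<^esub>a\<in>A. linear_factor a) (card A) = \<one>"
    and coeff_prod_linear_above: "card A < i \<Longrightarrow> coeff P (\<Otimes>\<^bsub>P\<^esub>a\<in>A. linear_factor a) i = \<zero>"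
    and coeff_prod_linear_sub: "A \<noteq> {} \<Longrightarrow>
      coeff P (\<Otimes>\<^bsub>P\<^esub>a\<in>A. linear_factor a) (card A - 1) = \<ominus> (\<Oplus>a\<in>A. a)"
proof -
  have "coeff P (\<Otimes>\<^bsub>P\<^esub>a\<in>A. linear_factor a) (card A) = \<one> \<and>
    (\<forall>i>card A. coeff P (\<Otimes>\<^bsub>P\<^esub>a\<in>A. linear_factor a) i = \<zero>) \<and>
    (A \<noteq> {} \<longrightarrow> coeff P (\<Otimes>\<^bsub>P\<^esub>a\<in>A. linear_factor a) (card A - 1) = \<ominus> (\<Oplus>a\<in>A. a))"
    using assms
  proof (induction rule: finite_induct)
    case empty
    then show ?case by simp
  next
    case (insert a A)
    define f where "f = (\<Otimes>\<^bsub>P\<^esub>a\<in>A. linear_factor a)"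
    have A: "A \<subseteq> carrier R" "a \<in> carrier R" using insert.prems by auto
    have f: "f \<in> carrier P" unfolding f_def using A(1) by (rule prod_linear_closed)
    have eq: "(\<Otimes>\<^bsub>P\<^esub>a\<in>insert a A. linear_factor a) = linear_factor a \<otimes>\<^bsub>P\<^esub> f"
      unfolding f_def using insert.hyps A by (subst P.finprod_insert) auto
    note IH = insert.IH[OF A(1), folded f_def]
    have sub: "coeff P (linear_factor a \<otimes>\<^bsub>P\<^esub> f) (card A) = \<ominus> (\<Oplus>a\<in>insert a A. a)"
    proof (cases "A = {}")
      \<comment> \<open>The recurrence speaks only of successor indices, so the constant coefficient
        of a single factor is read off directly.\<close>
      case True
      then have "f = \<one>\<^bsub>P\<^esub>" by (simp add: f_def)
      then show ?thesis using A(2) True by (simp add: a_minus_def)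
    next
      case False
      then obtain n where n: "card A = Suc n"
        using insert.hyps by (metis card_0_eq not0_implies_Suc)
      have S: "(\<Oplus>a\<in>A. a) \<in> carrier R" using A(1) by (intro R.finsum_closed) auto
      have "coeff P f n = \<ominus> (\<Oplus>a\<in>A. a)" "coeff P f (Suc n) = \<one>"
        using IH False n by auto
      moreover have "(\<Oplus>a\<in>insert a A. a) = a \<oplus> (\<Oplus>a\<in>A. a)"
        using insert.hyps A by (subst R.finsum_insert) auto
      ultimately show ?thesis
        unfolding n coeff_linear_factor_mult[OF A(2) f] using A(2) S
        by (simp add: R.minus_add a_minus_def R.a_comm)
    qed
    have top: "coeff P (linear_factor a \<otimes>\<^bsub>P\<^esub> f) (Suc (card A)) = \<one>"
      unfolding coeff_linear_factor_mult[OF A(2) f] using IH A by (simp add: a_minus_def)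
    have above: "coeff P (linear_factor a \<otimes>\<^bsub>P\<^esub> f) i = \<zero>" if "Suc (card A) < i" for i
    proof -
      obtain j where j: "i = Suc j" "card A < j" using \<open>Suc (card A) < i\<close> by (auto elim: Suc_lessE)
      show ?thesis
        unfolding j(1) coeff_linear_factor_mult[OF A(2) f] using IH A j(2) by (simp add: a_minus_def)
    qed
    show ?case
      unfolding eq card_insert_disjoint[OF insert.hyps] diff_Suc_1 using top above sub by blast
  qed
  then show "coeff P (\<Otimes>\<^bsub>P\<^esub>a\<in>A. linear_factor a) (card A) = \<one>"
    "card A < i \<Longrightarrow> coeff P (\<Otimes>\<^bsub>P\<^esub>a\<in>A. linear_factor a) i = \<zero>"
    "A \<noteq> {} \<Longrightarrow> coeff P (\<Otimes>\<^bsub>P\<^esub>a\<in>A. linear_factor a) (card A - 1) = \<ominus> (\<Oplus>a\<in>A. a)"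
    by auto
qed

lemma (in UP_cring) eval_id_ring_hom:
  "t \<in> carrier R \<Longrightarrow> ring_hom_cring P R (eval R R id t)"
  and eval_id_monom: "t \<in> carrier R \<Longrightarrow> a \<in> carrier R \<Longrightarrow>
    eval R R id t (monom P a n) = a \<otimes> t [^] n"
proof -
  interpret E: UP_pre_univ_prop R R id P
    by unfold_locales simp
  show "t \<in> carrier R \<Longrightarrow> ring_hom_cring P R (eval R R id t)"
    by (intro ring_hom_cringI UP_cring R.is_cring E.eval_ring_hom)
  show "t \<in> carrier R \<Longrightarrow> a \<in> carrier R \<Longrightarrow> eval R R id t (monom P a n) = a \<otimes> t [^] n"
    using E.eval_monom[of a t n] by simp
qed

text \<open>Evaluation is multiplicative, and in a domain a product of factors t - a vanishes only
  if one of them does.\<close>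

lemma (in UP_domain) eval_prod_linear_eq_zero_iff:
  assumes "finite A" "A \<subseteq> carrier R" "t \<in> carrier R"
  shows "eval R R id t (\<Otimes>\<^bsub>P\<^esub>a\<in>A. linear_factor a) = \<zero> \<longleftrightarrow> t \<in> A"
proof -
  define h where "h = eval R R id t"
  interpret h: ring_hom_cring P R h
    unfolding h_def using assms(3) by (rule eval_id_ring_hom)
  have h_factor: "h (linear_factor a) = t \<ominus> a" if "a \<in> carrier R" for a
    using that assms(3) eval_id_monom[of t \<one> 1, folded h_def] eval_id_monom[of t a 0, folded h_def]
    by (simp add: a_minus_def)
  show ?thesis
    using assms(1,2) unfolding h_def[symmetric]
  proof (induction rule: finite_induct)
    case empty
    then show ?case by simp
  next
    case (insert a A)
    have A: "A \<subseteq> carrier R" "a \<in> carrier R" using insert.prems by auto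
    have eq: "(\<Otimes>\<^bsub>P\<^esub>a\<in>insert a A. linear_factor a) =
        linear_factor a \<otimes>\<^bsub>P\<^esub> (\<Otimes>\<^bsub>P\<^esub>a\<in>A. linear_factor a)"
      using insert.hyps A by (subst P.finprod_insert) auto
    have "h (linear_factor a \<otimes>\<^bsub>P\<^esub> (\<Otimes>\<^bsub>P\<^esub>a\<in>A. linear_factor a)) =
        (t \<ominus> a) \<otimes> h (\<Otimes>\<^bsub>P\<^esub>a\<in>A. linear_factor a)"
      using A prod_linear_closed[OF A(1)] h_factor by (subst h.hom_mult) auto
    moreover have "t \<ominus> a = \<zero> \<longleftrightarrow> t = a"
      using A assms(3) by (rule_tac R.r_right_minus_eq) auto
    moreover have "h (\<Otimes>\<^bsub>P\<^esub>a\<in>A. linear_factor a) \<in> carrier R"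
      using prod_linear_closed[OF A(1)] by (rule h.hom_closed)
    ultimately show ?case
      unfolding eq using insert.IH[OF A(1)] A assms(3) by (simp add: R.integral_iff)
  qed
qed

lemma powr_half_nat: "0 < x \<Longrightarrow> x powr (real n / 2) = sqrt (x ^ n)"
  by (simp add: powr_half_sqrt[symmetric] powr_realpow[symmetric] powr_powr)

section \<open>The construction\<close>

text \<open>One construction at a time. The asymptotic lemmas quantify over constructions outside
  this locale and enter it by interpretation, which keeps their constants independent of the
  construction.\<close>

locale rn_system = fixes d :: nat and C :: "'a rn_data" (structure)
  assumes d_ge_3: "3 \<le> d" and construction: "rn_construction d C"
begin

abbreviation "V \<equiv> coord_space d C"

lemma field_C: "field C"
  and finite_carrier: "finite (carrier C)"
  and odd_order: "odd (order C)"
  and quadratic: "quadratic_form d C"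
  and witt: "witt_decomposition d C"
  and basis: "wperp_basis d C"
  and kappa_closed [simp]: "kappa C \<in> carrier C"
  using construction by (auto simp: rn_construction_def)

sublocale field C by (rule field_C)
sublocale V: Module.module C V by (rule coord_space_module)
sublocale P: UP_domain C "UP C" by unfold_locales

lemma finite_points [simp]: "finite (points d C)"
  by (simp add: coord_space_def finite_PiE finite_carrier)

lemma order_pos: "0 < order C"
  using odd_order by (simp add: odd_pos)

text \<open>The order of the additive group annihilates one. If two were zero, oddness of the order
  would leave one equal to zero.\<close>

lemma two_nonzero: "\<one> \<oplus> \<one> \<noteq> \<zero>"
proof
  assume two: "\<one> \<oplus> \<one> = \<zero>"
  have "add_pow C (order C) \<one> = \<zero>"
    using add.pow_order_eq_1[of \<one>] by (simp add: order_def)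
  moreover obtain k where "order C = Suc (2 * k)"
    using odd_order by (auto elim: oddE)
  moreover have "add_pow C (2 * k) \<one> = \<zero>" for k :: nat
  proof (induction k)
    case (Suc k)
    have "add_pow C (2 * Suc k) \<one> = add_pow C (2 * k) \<one> \<oplus> (\<one> \<oplus> \<one>)"
      by (simp add: a_assoc)
    then show ?case using Suc two by simp
  qed simp
  ultimately show False by simp
qed

section \<open>The Witt decomposition and its coordinates\<close>

lemma wperp_submodule: "submodule (wperp C) C V"
  using witt by (simp add: witt_decomposition_def)

lemma hyp_closed [simp]: "hyp_e C \<in> carrier V" "hyp_f C \<in> carrier V"
  using witt by (simp_all add: witt_decomposition_def)

lemma wperp_closed [simp]: "z \<in> wperp C \<Longrightarrow> z \<in> carrier V"
  using V.submoduleE(1)[OF wperp_submodule] by auto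

lemma wperp_add [simp]: "z \<in> wperp C \<Longrightarrow> w \<in> wperp C \<Longrightarrow> z \<oplus>\<^bsub>V\<^esub> w \<in> wperp C"
  by (rule V.submoduleE(5)[OF wperp_submodule])

lemma wperp_minus [simp]: "z \<in> wperp C \<Longrightarrow> \<ominus>\<^bsub>V\<^esub> z \<in> wperp C"
  by (rule V.submoduleE(3)[OF wperp_submodule])

lemma wperp_smult [simp]: "a \<in> carrier C \<Longrightarrow> z \<in> wperp C \<Longrightarrow> a \<odot>\<^bsub>V\<^esub> z \<in> wperp C"
  by (rule V.submoduleE(4)[OF wperp_submodule])

lemma wperp_zero [simp]: "\<zero>\<^bsub>V\<^esub> \<in> wperp C"
  using subgroup.one_closed[OF submodule.axioms(1)[OF wperp_submodule]] by simp

lemma wbasis_wperp [simp]: "j \<in> {1..d-2} \<Longrightarrow> wbasis C j \<in> wperp C"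
  using basis by (auto simp: wperp_basis_def)

lemma wperp_finsum:
  "finite J \<Longrightarrow> w \<in> J \<rightarrow> wperp C \<Longrightarrow> (\<Oplus>\<^bsub>V\<^esub>j\<in>J. w j) \<in> wperp C"
proof (induction J rule: finite_induct)
  case (insert j J)
  then have "w \<in> J \<rightarrow> carrier V" "w j \<in> carrier V" "w \<in> J \<rightarrow> wperp C" "w j \<in> wperp C" 
    by (auto simp: Pi_iff)
  with insert show ?case by simp
qed simp

lemma wpoint_closed [simp]:
  "\<lbrakk>x \<in> carrier C; y \<in> carrier C; z \<in> wperp C\<rbrakk> \<Longrightarrow> wpoint d C x y z \<in> carrier V"
  by (simp add: wpoint_def)

lemma wpoint_inject:
  "\<lbrakk>x \<in> carrier C; y \<in> carrier C; z \<in> wperp C; x' \<in> carrier C; y' \<in> carrier C; z' \<in> wperp C\<rbrakk>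
    \<Longrightarrow> wpoint d C x y z = wpoint d C x' y' z' \<longleftrightarrow> x = x' \<and> y = y' \<and> z = z'"
  using witt by (auto simp: witt_decomposition_def bij_betw_def dest!: inj_onD[where x="(x,y,z)" and y="(x',y',z')"])

lemma qform_wpoint:
  "\<lbrakk>x \<in> carrier C; y \<in> carrier C; z \<in> wperp C\<rbrakk>
    \<Longrightarrow> qform C (wpoint d C x y z) = x \<otimes> y \<oplus> qform C z"
  using witt by (simp add: witt_decomposition_def)

lemma wpoint_minus:
  assumes "x \<in> carrier C" "y \<in> carrier C" "z \<in> wperp C"
    "x' \<in> carrier C" "y' \<in> carrier C" "z' \<in> wperp C"
  shows "wpoint d C x y z \<ominus>\<^bsub>V\<^esub> wpoint d C x' y' z'
    = wpoint d C (x \<ominus> x') (y \<ominus> y') (z \<ominus>\<^bsub>V\<^esub> z')"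
proof -
  have "z \<ominus>\<^bsub>V\<^esub> z' \<in> wperp C" using assms by (simp add: V.minus_eq)
  then show ?thesis
    using assms
    by (simp add: wpoint_def minus_eq V.minus_eq V.smult_l_distr V.smult_l_minus V.minus_add
        V.a_assoc V.a_comm V.a_lcomm)
qed

section \<open>The quadratic form and its bilinear form\<close>

lemma qform_closed [simp]: "v \<in> carrier V \<Longrightarrow> qform C v \<in> carrier C"
  using quadratic by (auto simp: quadratic_form_def)

lemma inv_two_closed [simp]: "inv (\<one> \<oplus> \<one>) \<in> carrier C"
  using two_nonzero by (simp add: field_Units)

lemma qinner_closed [simp]:
  "v \<in> carrier V \<Longrightarrow> w \<in> carrier V \<Longrightarrow> qinner d C v w \<in> carrier C"
  by (simp add: qinner_def)

lemma two_qinner: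
  assumes "v \<in> carrier V" "w \<in> carrier V"
  shows "(\<one> \<oplus> \<one>) \<otimes> qinner d C v w = qform C (v \<oplus>\<^bsub>V\<^esub> w) \<ominus> qform C v \<ominus> qform C w"
proof -
  have "(\<one> \<oplus> \<one>) \<otimes> inv (\<one> \<oplus> \<one>) = \<one>"
    using two_nonzero by (simp add: field_Units Units_r_inv)
  moreover have "(\<one> \<oplus> \<one>) \<otimes> (a \<otimes> inv (\<one> \<oplus> \<one>)) = (\<one> \<oplus> \<one>) \<otimes> inv (\<one> \<oplus> \<one>) \<otimes> a"
    if "a \<in> carrier C" for a
    using that by (simp only: m_ac a_closed one_closed inv_two_closed m_closed)
  ultimately show ?thesis
    using assms unfolding qinner_def by simp
qed

lemma qinner_commute:
  "v \<in> carrier V \<Longrightarrow> w \<in> carrier V \<Longrightarrow> qinner d C v w = qinner d C w v"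
  by (simp add: qinner_def V.a_comm minus_eq a_assoc a_comm a_lcomm)

lemma qinner_add_left:
  "\<lbrakk>u \<in> carrier V; v \<in> carrier V; w \<in> carrier V\<rbrakk>
    \<Longrightarrow> qinner d C (u \<oplus>\<^bsub>V\<^esub> v) w = qinner d C u w \<oplus> qinner d C v w"
  using quadratic by (simp add: quadratic_form_def)

lemma qinner_smult_left:
  "\<lbrakk>a \<in> carrier C; v \<in> carrier V; w \<in> carrier V\<rbrakk>
    \<Longrightarrow> qinner d C (a \<odot>\<^bsub>V\<^esub> v) w = a \<otimes> qinner d C v w"
  using quadratic by (simp add: quadratic_form_def)

lemma qinner_add_right:
  "\<lbrakk>u \<in> carrier V; v \<in> carrier V; w \<in> carrier V\<rbrakk>
    \<Longrightarrow> qinner d C w (u \<oplus>\<^bsub>V\<^esub> v) = qinner d C w u \<oplus> qinner d C w v"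
  by (simp add: qinner_commute[of w] qinner_add_left)

lemma qinner_smult_right:
  "\<lbrakk>a \<in> carrier C; v \<in> carrier V; w \<in> carrier V\<rbrakk>
    \<Longrightarrow> qinner d C w (a \<odot>\<^bsub>V\<^esub> v) = a \<otimes> qinner d C w v"
  by (simp add: qinner_commute[of w] qinner_smult_left)

lemma qinner_minus_left:
  "v \<in> carrier V \<Longrightarrow> w \<in> carrier V \<Longrightarrow> qinner d C (\<ominus>\<^bsub>V\<^esub> v) w = \<ominus> qinner d C v w"
  using qinner_smult_left[of "\<ominus> \<one>" v w] by (simp add: V.smult_l_minus l_minus)

lemma qinner_zero_right: "w \<in> carrier V \<Longrightarrow> qinner d C w \<zero>\<^bsub>V\<^esub> = \<zero>"
  using qinner_smult_right[of \<zero> w w] by simp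

lemma qinner_finsum_right:
  assumes "finite J" "v \<in> J \<rightarrow> carrier V" "w \<in> carrier V"
  shows "qinner d C w (\<Oplus>\<^bsub>V\<^esub>j\<in>J. v j) = (\<Oplus>j\<in>J. qinner d C w (v j))"
  using assms(1,2)
proof (induction J rule: finite_induct)
  case empty
  then show ?case using assms(3) by (simp add: qinner_zero_right)
next
  case (insert j J)
  then have "v \<in> J \<rightarrow> carrier V" "v j \<in> carrier V" by auto
  with insert assms(3) show ?case
    by (simp add: qinner_add_right Pi_iff)
qed

lemma qform_minus: "v \<in> carrier V \<Longrightarrow> qform C (\<ominus>\<^bsub>V\<^esub> v) = qform C v"
proof -
  assume v: "v \<in> carrier V"
  have "qform C ((\<ominus> \<one>) \<odot>\<^bsub>V\<^esub> v) = (\<ominus> \<one>) [^] (2::nat) \<otimes> qform C v"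
    using quadratic v by (simp add: quadratic_form_def)
  then show ?thesis
    using v by (simp add: V.smult_l_minus numeral_2_eq_2 l_minus r_minus)
qed

lemma qform_diff:
  assumes "v \<in> carrier V" "w \<in> carrier V"
  shows "qform C (v \<ominus>\<^bsub>V\<^esub> w) = qform C v \<oplus> qform C w \<ominus> (\<one> \<oplus> \<one>) \<otimes> qinner d C v w"
proof -
  \<comment> \<open>Polarization is applied to the pair -w, v, whose sum is v - w.\<close>
  have "(\<one> \<oplus> \<one>) \<otimes> qinner d C (\<ominus>\<^bsub>V\<^esub> w) v = \<ominus> ((\<one> \<oplus> \<one>) \<otimes> qinner d C v w)"
    using assms by (simp add: qinner_minus_left r_minus qinner_commute[of w v])
  then have *: "qform C (\<ominus>\<^bsub>V\<^esub> w \<oplus>\<^bsub>V\<^esub> v) \<ominus> qform C w \<ominus> qform C v =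
      \<ominus> ((\<one> \<oplus> \<one>) \<otimes> qinner d C v w)"
    using assms two_qinner[of "\<ominus>\<^bsub>V\<^esub> w" v] by (simp add: qform_minus)
  have "\<ominus>\<^bsub>V\<^esub> w \<oplus>\<^bsub>V\<^esub> v = v \<ominus>\<^bsub>V\<^esub> w"
    using assms by (simp add: V.minus_eq V.a_comm)
  moreover have "a = c \<oplus> b \<oplus> (a \<ominus> b \<ominus> c)" if "a \<in> carrier C" "b \<in> carrier C" "c \<in> carrier C" for a b c
  proof -
    have "c \<oplus> b \<oplus> (a \<ominus> b \<ominus> c) = a \<oplus> (b \<ominus> b) \<oplus> (c \<ominus> c)"
      using that by (simp only: minus_eq a_ac a_closed a_inv_closed)
    then show ?thesis using that by (simp only: minus_eq r_neg r_zero)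
  qed
  note this[of "qform C (\<ominus>\<^bsub>V\<^esub> w \<oplus>\<^bsub>V\<^esub> v)" "qform C w" "qform C v", unfolded *]
  ultimately show ?thesis
    using assms by (simp add: minus_eq)
qed

section \<open>Centers and spheres of the rational normal system\<close>

lemma rn_z_wperp [simp]: "t \<in> carrier C \<Longrightarrow> rn_z d C t \<in> wperp C"
  unfolding rn_z_def by (rule wperp_finsum) auto

lemma rn_center_eq:
  "t \<in> carrier C \<Longrightarrow> rn_center d C t = wpoint d C \<zero> (t [^] (d-1)) (rn_z d C t)"
  by (simp add: rn_center_def wpoint_def)

lemma rn_center_closed [simp]: "t \<in> carrier C \<Longrightarrow> rn_center d C t \<in> carrier V"
  by (simp add: rn_center_eq)

lemma qform_rn_center: "t \<in> carrier C \<Longrightarrow> qform C (rn_center d C t) = qform C (rn_z d C t)"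
  by (simp add: rn_center_eq qform_wpoint)

lemma rn_gamma_closed [simp]: "rn_gamma d C \<in> carrier C"
  by (simp add: rn_gamma_def)

lemma rn_radius_closed [simp]: "t \<in> carrier C \<Longrightarrow> rn_radius d C t \<in> carrier C"
  by (simp add: rn_radius_def rn_b_def)

text \<open>The coefficient of the first basis vector in z_t is t itself, and d \<ge> 3 guarantees
  that this vector exists. Distinct labels thus give distinct spheres.\<close>

lemma rn_center_inj: "inj_on (rn_center d C) (carrier C)"
proof (rule inj_onI)
  fix s t assume st: "s \<in> carrier C" "t \<in> carrier C" "rn_center d C s = rn_center d C t"
  define J where "J = {1..d-2}"
  \<comment> \<open>Powers are cut down to \<open>J\<close> because the basis map is injective only
    on the extensional functions over \<open>J\<close>.\<close>
  define p where "p t = (\<lambda>j\<in>J. t [^] (j::nat))" for t :: 'a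
  have inj: "inj_on (\<lambda>a. \<Oplus>\<^bsub>V\<^esub>j\<in>J. a j \<odot>\<^bsub>V\<^esub> wbasis C j) (J \<rightarrow>\<^sub>E carrier C)"
    using basis by (simp add: wperp_basis_def bij_betw_def J_def)
  have eq: "rn_z d C t = (\<Oplus>\<^bsub>V\<^esub>j\<in>J. p t j \<odot>\<^bsub>V\<^esub> wbasis C j)" if "t \<in> carrier C" for t
    unfolding rn_z_def J_def[symmetric]
    using that by (intro V.finsum_cong') (auto simp: p_def J_def)
  have "rn_z d C s = rn_z d C t"
    using st by (simp add: rn_center_eq wpoint_inject)
  moreover have "p s \<in> J \<rightarrow>\<^sub>E carrier C" "p t \<in> J \<rightarrow>\<^sub>E carrier C"
    using st by (auto simp: p_def)
  ultimately have "p s = p t"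
    using inj_onD[OF inj, of "p s" "p t"] eq st by simp
  then have "p s 1 = p t 1" by simp
  moreover have "1 \<in> J" using d_ge_3 by (simp add: J_def)
  ultimately have "s [^] (1::nat) = t [^] (1::nat)" by (simp add: p_def)
  then show "s = t" using st by simp
qed

lemma rn_spheres_subset: "rn_spheres d C \<subseteq> spheres d C"
  by (auto simp: rn_spheres_def)

lemma card_rn_spheres: "card (rn_spheres d C) = order C"
  unfolding rn_spheres_def order_def
  by (rule card_image) (auto intro: inj_onI dest: inj_onD[OF rn_center_inj])

section \<open>Coefficients and values of Psi\<close>

lemma rn_Psi_closed [simp]:
  "\<lbrakk>x \<in> carrier C; y \<in> carrier C; z \<in> wperp C\<rbrakk> \<Longrightarrow> rn_Psi d C x y z \<in> carrier (UP C)"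
  unfolding rn_Psi_def
  by (intro P.UP_a_closed P.P.finsum_closed P.monom_closed Pi_I) auto

text \<open>As d \<ge> 3, the exponents d, d - 1, those in \<open>{1..d-2}\<close> and 0 are
  pairwise distinct, so no two summands of Psi meet in one coefficient.\<close>

lemma coeff_rn_Psi:
  assumes "x \<in> carrier C" "y \<in> carrier C" "z \<in> wperp C"
  shows "coeff (UP C) (rn_Psi d C x y z) i =
    (if i = d then \<one> else if i = d - 1 then x \<oplus> rn_gamma d C
     else if i \<in> {1..d-2} then (\<one> \<oplus> \<one>) \<otimes> qinner d C z (wbasis C i)
     else if i = 0 then kappa C \<ominus> qform C (wpoint d C x y z) else \<zero>)"
proof -
  define a where "a j = (\<one> \<oplus> \<one>) \<otimes> qinner d C z (wbasis C j)" for j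
  have a: "a j \<in> carrier C" if "j \<in> {1..d-2}" for j
    using that assms by (simp add: a_def)
  have "coeff (UP C) (\<Oplus>\<^bsub>UP C\<^esub>j\<in>{1..d-2}. monom (UP C) (a j) j) i =
      (\<Oplus>j\<in>{1..d-2}. coeff (UP C) (monom (UP C) (a j) j) i)"
    by (rule P.coeff_finsum) (use a in auto)
  also have "\<dots> = (\<Oplus>j\<in>{1..d-2}. if i = j then a j else \<zero>)"
    by (intro finsum_cong') (use a in auto)
  also have "\<dots> = (if i \<in> {1..d-2} then a i else \<zero>)"
  proof (cases "i \<in> {1..d-2}")
    case True
    then show ?thesis using a add.finprod_singleton[of i "{1..d-2}" a] by simp
  next
    case False
    then have "(\<Oplus>j\<in>{1..d-2}. if i = j then a j else \<zero>) = (\<Oplus>j\<in>{1..d-2}. \<zero>)"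
      by (intro finsum_cong') auto
    then show ?thesis unfolding if_not_P[OF False] by simp
  qed
  finally have *: "coeff (UP C) (\<Oplus>\<^bsub>UP C\<^esub>j\<in>{1..d-2}. monom (UP C) (a j) j) i = \<dots>" .
  have "(\<Oplus>\<^bsub>UP C\<^esub>j\<in>{1..d-2}. monom (UP C) (a j) j) \<in> carrier (UP C)"
    using a by (intro P.P.finsum_closed) auto
  then show ?thesis
    unfolding rn_Psi_def a_def[symmetric]
    using assms * d_ge_3 a by (auto split del: if_split) (auto simp: P.coeff_monom)
qed

text \<open>The center c_t has Witt coordinates 0, t^(d-1), z_t, so Q(p - c_t) = x (y - t^(d-1)) +
  Q(z - z_t). Subtracting this from r_t cancels Q(z_t) = Q(c_t), and what remains is the value at t
  of a polynomial whose coefficients depend only on p. This identity converts incidences into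
  roots.\<close>

lemma eval_rn_Psi:
  assumes "x \<in> carrier C" "y \<in> carrier C" "z \<in> wperp C" "t \<in> carrier C"
  shows "eval C C id t (rn_Psi d C x y z) =
    rn_radius d C t \<ominus> qform C (wpoint d C x y z \<ominus>\<^bsub>V\<^esub> rn_center d C t)"
proof -
  define h where "h = eval C C id t"
  interpret h: ring_hom_cring "UP C" C h
    unfolding h_def using assms(4) by (rule P.eval_id_ring_hom)
  have h_monom: "h (monom (UP C) a n) = a \<otimes> t [^] n" if "a \<in> carrier C" for a n
    unfolding h_def using assms(4) that by (rule P.eval_id_monom)
  define s where "s = t [^] (d-1)"
  define w where "w = rn_z d C t"
  \<comment> \<open>The cross term of Q(z - z_t), which is also the value at t of the middle terms
    of Psi.\<close>
  define I where "I = (\<one> \<oplus> \<one>) \<otimes> qinner d C z w"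
  have s: "s \<in> carrier C" and w: "w \<in> wperp C" and I: "I \<in> carrier C"
    using assms by (auto simp: s_def w_def I_def)
  define m where "m j = monom (UP C) ((\<one> \<oplus> \<one>) \<otimes> qinner d C z (wbasis C j)) j" for j
  have m: "m \<in> {1..d-2} \<rightarrow> carrier (UP C)"
    using assms by (auto simp: m_def)
  have "qinner d C z w = (\<Oplus>j\<in>{1..d-2}. qinner d C z ((t [^] j) \<odot>\<^bsub>V\<^esub> wbasis C j))"
    unfolding w_def rn_z_def using assms by (intro qinner_finsum_right) auto
  also have "\<dots> = (\<Oplus>j\<in>{1..d-2}. t [^] j \<otimes> qinner d C z (wbasis C j))"
    using assms by (intro finsum_cong') (auto simp: qinner_smult_right)
  finally have "I = (\<Oplus>j\<in>{1..d-2}. (\<one> \<oplus> \<one>) \<otimes> (t [^] j \<otimes> qinner d C z (wbasis C j)))"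
    unfolding I_def using assms by (subst finsum_rdistr[symmetric]) auto
  also have "\<dots> = (\<Oplus>j\<in>{1..d-2}. (h \<circ> m) j)"
    using assms by (intro finsum_cong') (auto simp: h_monom m_ac m_def)
  also have "\<dots> = h (\<Oplus>\<^bsub>UP C\<^esub>j\<in>{1..d-2}. m j)"
    using h.hom_finsum[OF m] by simp
  finally have hI: "h (\<Oplus>\<^bsub>UP C\<^esub>j\<in>{1..d-2}. m j) = I" ..
  have "(\<Oplus>\<^bsub>UP C\<^esub>j\<in>{1..d-2}. m j) \<in> carrier (UP C)"
    using m by (rule P.P.finsum_closed)
  then have "h (rn_Psi d C x y z) = t [^] d \<oplus> (x \<oplus> rn_gamma d C) \<otimes> s \<oplus> I \<oplus> (kappa C \<ominus> (x \<otimes> y \<oplus> qform C z))"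
    unfolding rn_Psi_def m_def[symmetric]
    using assms by (simp add: h_monom s_def qform_wpoint hI[simplified] del: P.monom_one P.monom_add) 
  also have "\<dots> = (t [^] d \<oplus> rn_gamma d C \<otimes> s \<oplus> kappa C) \<ominus> (x \<otimes> y \<ominus> x \<otimes> s \<oplus> qform C z \<ominus> I)"
  proof -
    \<comment> \<open>Stated for arbitrary elements so that the products become atoms for AC
      rewriting.\<close>
    have "T \<oplus> (B \<oplus> g) \<oplus> i \<oplus> (k \<ominus> (A \<oplus> q)) = (T \<oplus> g \<oplus> k) \<ominus> (A \<ominus> B \<oplus> q \<ominus> i)"
      if "T \<in> carrier C" "B \<in> carrier C" "g \<in> carrier C" "i \<in> carrier C" "k \<in> carrier C"
        "A \<in> carrier C" "q \<in> carrier C" for T B g i k A q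
      using that by (simp only: minus_eq minus_add minus_minus a_ac a_closed a_inv_closed)
    from this[of "t [^] d" "x \<otimes> s" "rn_gamma d C \<otimes> s" I "kappa C" "x \<otimes> y" "qform C z"]
    show ?thesis using assms s I by (simp only: l_distr rn_gamma_closed m_closed kappa_closed
      nat_pow_closed qform_closed wperp_closed)
  qed
  \<comment> \<open>Adding Q(z_t) to both brackets turns the first into r_t and the second into Q(p
    - c_t).\<close>
  also have "\<dots> = (qform C w \<oplus> (t [^] d \<oplus> rn_gamma d C \<otimes> s \<oplus> kappa C)) \<ominus>
      (qform C w \<oplus> (x \<otimes> y \<ominus> x \<otimes> s \<oplus> qform C z \<ominus> I))"
  proof -
    have "a \<ominus> b = (c \<oplus> a) \<ominus> (c \<oplus> b)" if "a \<in> carrier C" "b \<in> carrier C" "c \<in> carrier C" for a b c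
    proof -
      have "(c \<oplus> a) \<ominus> (c \<oplus> b) = a \<ominus> b \<oplus> (c \<oplus> \<ominus> c)"
        using that by (simp only: minus_eq minus_add a_ac a_closed a_inv_closed)
      then show ?thesis using that by (simp only: r_neg r_zero minus_closed)
    qed
    from this[of "t [^] d \<oplus> rn_gamma d C \<otimes> s \<oplus> kappa C"
        "x \<otimes> y \<ominus> x \<otimes> s \<oplus> qform C z \<ominus> I" "qform C w"]
    show ?thesis using assms s w I by (simp only: a_closed minus_closed m_closed kappa_closed
      nat_pow_closed qform_closed wperp_closed rn_gamma_closed)
  qed
  also have "qform C w \<oplus> (t [^] d \<oplus> rn_gamma d C \<otimes> s \<oplus> kappa C) = rn_radius d C t"
    using assms by (simp add: rn_radius_def rn_b_def qform_rn_center s_def w_def)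
  also have "qform C w \<oplus> (x \<otimes> y \<ominus> x \<otimes> s \<oplus> qform C z \<ominus> I) =
      qform C (wpoint d C x y z \<ominus>\<^bsub>V\<^esub> rn_center d C t)"
  proof -
    have "z \<ominus>\<^bsub>V\<^esub> w \<in> wperp C" using assms w by (simp add: V.minus_eq)
    then have "qform C (wpoint d C x y z \<ominus>\<^bsub>V\<^esub> rn_center d C t) =
        x \<otimes> (y \<ominus> s) \<oplus> qform C (z \<ominus>\<^bsub>V\<^esub> w)"
      using assms s w
      by (simp add: rn_center_eq s_def[symmetric] w_def[symmetric] wpoint_minus qform_wpoint)
         (simp add: minus_eq s_def)
    also have "\<dots> = x \<otimes> (y \<ominus> s) \<oplus> (qform C z \<oplus> qform C w \<ominus> I)"
      using assms w by (simp add: qform_diff I_def)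
    finally have "qform C (wpoint d C x y z \<ominus>\<^bsub>V\<^esub> rn_center d C t) = \<dots>" .
    moreover have "x \<otimes> (y \<ominus> s) \<oplus> (qform C z \<oplus> qform C w \<ominus> I) =
      qform C w \<oplus> (x \<otimes> y \<ominus> x \<otimes> s \<oplus> qform C z \<ominus> I)"
    proof -
      have "A \<ominus> B \<oplus> (q \<oplus> r \<ominus> i) = r \<oplus> (A \<ominus> B \<oplus> q \<ominus> i)"
        if "A \<in> carrier C" "B \<in> carrier C" "q \<in> carrier C" "r \<in> carrier C" "i \<in> carrier C"
        for A B q r i
        using that by (simp only: minus_eq a_ac a_closed a_inv_closed)
      from this[of "x \<otimes> y" "x \<otimes> s" "qform C z" "qform C w" I]
      have "x \<otimes> y \<ominus> x \<otimes> s \<oplus> (qform C z \<oplus> qform C w \<ominus> I) =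
          qform C w \<oplus> (x \<otimes> y \<ominus> x \<otimes> s \<oplus> qform C z \<ominus> I)"
        using assms s w I by (simp only: m_closed qform_closed wperp_closed)
      moreover have "x \<otimes> (y \<ominus> s) = x \<otimes> y \<ominus> x \<otimes> s"
        using assms s by (simp only: minus_eq r_distr r_minus a_inv_closed)
      ultimately show ?thesis by (simp only:)
    qed
    ultimately show ?thesis by (simp only:)
  qed
  finally show ?thesis unfolding h_def .
qed

text \<open>The difference of the two vectors pairs to zero with the basis, hence with all of V_0,
  and Q is nondegenerate there. The factor two, kept because it occurs in Psi, cancels in odd
  characteristic.\<close>

lemma wperp_eqI:
  assumes z: "z \<in> wperp C" "z' \<in> wperp C"
    and eq: "\<And>j. j \<in> {1..d-2} \<Longrightarrow> (\<one> \<oplus> \<one>) \<otimes> qinner d C z (wbasis C j) = (\<one> \<oplus> \<one>) \<otimes> qinner d C z' (wbasis C j)"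
  shows "z = z'"
proof -
  define y where "y = z \<ominus>\<^bsub>V\<^esub> z'"
  have y: "y \<in> wperp C" using z by (simp add: y_def V.minus_eq)
  have y_basis: "qinner d C y (wbasis C j) = \<zero>" if j: "j \<in> {1..d-2}" for j
  proof -
    have "qinner d C z (wbasis C j) = qinner d C z' (wbasis C j)"
      using eq[OF j] j z two_nonzero by (subst (asm) m_lcancel) auto
    then show ?thesis
      using j z unfolding y_def V.minus_eq by (subst qinner_add_left) (auto simp: qinner_minus_left r_neg)
  qed
  have "qinner d C y w = \<zero>" if w: "w \<in> wperp C" for w
  proof -
    obtain a where a: "a \<in> {1..d-2} \<rightarrow>\<^sub>E carrier C"
        "w = (\<Oplus>\<^bsub>V\<^esub>j\<in>{1..d-2}. a j \<odot>\<^bsub>V\<^esub> wbasis C j)"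
      using basis w unfolding wperp_basis_def bij_betw_def by blast
    have aj: "a j \<in> carrier C" if "j \<in> {1..d-2}" for j
      using a(1) that by (rule PiE_mem)
    have "qinner d C y w = (\<Oplus>j\<in>{1..d-2}. qinner d C y (a j \<odot>\<^bsub>V\<^esub> wbasis C j))"
      unfolding a(2) using y aj by (intro qinner_finsum_right) auto
    also have "\<dots> = (\<Oplus>j\<in>{1..d-2}. \<zero>)"
      using y aj y_basis by (intro finsum_cong') (auto simp: qinner_smult_right)
    finally show ?thesis by simp
  qed
  then have "y = \<zero>\<^bsub>V\<^esub>"
    using witt y by (auto simp: witt_decomposition_def nondegenerate_on_def)
  moreover have "z = y \<oplus>\<^bsub>V\<^esub> z'"
    using z by (simp add: y_def V.minus_eq V.a_assoc V.l_neg)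
  ultimately show ?thesis
    using z by simp
qed

text \<open>
  The pairings with the basis determine a vector of $V_0$, so by counting they can be prescribed.
\<close>

lemma ex_wperp_qinner:
  assumes "\<And>j. j \<in> {1..d-2} \<Longrightarrow> c j \<in> carrier C"
  shows "\<exists>z\<in>wperp C. \<forall>j\<in>{1..d-2}. (\<one> \<oplus> \<one>) \<otimes> qinner d C z (wbasis C j) = c j"
proof -
  define L where "L z = (\<lambda>j\<in>{1..d-2}. (\<one> \<oplus> \<one>) \<otimes> qinner d C z (wbasis C j))" for z
  have sub: "L ` wperp C \<subseteq> {1..d-2} \<rightarrow>\<^sub>E carrier C"
    unfolding L_def by (intro image_subsetI restrict_PiE_iff[THEN iffD2] ballI m_closed qinner_closed
      a_closed one_closed wperp_closed wbasis_wperp)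
  have inj: "inj_on L (wperp C)"
  proof (rule inj_onI)
    fix z z' assume zz: "z \<in> wperp C" "z' \<in> wperp C" and L: "L z = L z'"
    show "z = z'"
    proof (rule wperp_eqI[OF zz])
      fix j assume "j \<in> {1..d-2}"
      then show "(\<one> \<oplus> \<one>) \<otimes> qinner d C z (wbasis C j) = (\<one> \<oplus> \<one>) \<otimes> qinner d C z' (wbasis C j)"
        using fun_cong[OF L, of j] unfolding L_def by (simp only: restrict_apply')
    qed
  qed
  \<comment> \<open>The basis parametrizes V_0 by the very function space that is the target of
    \<open>L\<close>, so an injective \<open>L\<close> is onto.\<close>
  have "card (L ` wperp C) = card ({1..d-2} \<rightarrow>\<^sub>E carrier C)"
    using basis card_image[OF inj] bij_betw_same_card by (fastforce simp: wperp_basis_def)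
  then have "L ` wperp C = {1..d-2} \<rightarrow>\<^sub>E carrier C"
    by (intro card_subset_eq sub) (simp_all add: finite_PiE finite_carrier)
  moreover have "restrict c {1..d-2} \<in> {1..d-2} \<rightarrow>\<^sub>E carrier C"
    using assms by auto
  ultimately obtain z where z: "z \<in> wperp C" "L z = restrict c {1..d-2}"
    by (metis imageE)
  have "(\<one> \<oplus> \<one>) \<otimes> qinner d C z (wbasis C j) = c j" if "j \<in> {1..d-2}" for j
    using fun_cong[OF z(2), of j] that unfolding L_def by (simp only: restrict_apply')
  with z(1) show ?thesis by blast
qed

section \<open>The points attached to admissible sets\<close>

abbreviation root_poly where
  "root_poly A \<equiv> (\<Otimes>\<^bsub>UP C\<^esub>a\<in>A. monom (UP C) \<one> 1 \<ominus>\<^bsub>UP C\<^esub> monom (UP C) a 0)"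

lemma admissible_finite: "A \<in> admissible d C \<Longrightarrow> finite A"
  using d_ge_3 by (auto simp: admissible_def intro: card_ge_0_finite)

lemma finite_admissible [simp]: "finite (admissible d C)"
  by (rule finite_subset[of _ "Pow (carrier C)"]) (auto simp: admissible_def finite_carrier)

text \<open>Comparing coefficients yields a triangular system: the coefficient at d - 1 fixes x by
  Vieta, the middle ones fix the pairings of z, and y occurs only in the constant term, multiplied
  by x.\<close>

lemma rn_Psi_eq_root_poly_iff:
  assumes A: "A \<in> admissible d C"
    and xyz: "x \<in> carrier C" "y \<in> carrier C" "z \<in> wperp C"
  shows "rn_Psi d C x y z = root_poly A \<longleftrightarrow>
    x = \<ominus> (\<Oplus>a\<in>A. a) \<ominus> rn_gamma d C \<and>
    (\<forall>j\<in>{1..d-2}. (\<one> \<oplus> \<one>) \<otimes> qinner d C z (wbasis C j) = coeff (UP C) (root_poly A) j) \<and>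
    x \<otimes> y = kappa C \<ominus> coeff (UP C) (root_poly A) 0 \<ominus> qform C z"
proof -
  have A': "A \<subseteq> carrier C" "card A = d" "finite A" "A \<noteq> {}"
    using A admissible_finite[OF A] d_ge_3 by (auto simp: admissible_def)
  note f = P.prod_linear_closed[OF A'(1)]
  note top = P.coeff_prod_linear_top[OF A'(3,1), unfolded A'(2)]
    and above = P.coeff_prod_linear_above[OF A'(3,1), unfolded A'(2)]
    and sub = P.coeff_prod_linear_sub[OF A'(3,1,4), unfolded A'(2)]
  have S: "(\<Oplus>a\<in>A. a) \<in> carrier C" using A'(1) by (intro finsum_closed) auto
  have "rn_Psi d C x y z = root_poly A \<longleftrightarrow>
      (\<forall>i. coeff (UP C) (rn_Psi d C x y z) i = coeff (UP C) (root_poly A) i)"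
    using P.up_eqI f xyz by (metis rn_Psi_closed)
  also have "\<dots> \<longleftrightarrow> x \<oplus> rn_gamma d C = \<ominus> (\<Oplus>a\<in>A. a) \<and>
    (\<forall>j\<in>{1..d-2}. (\<one> \<oplus> \<one>) \<otimes> qinner d C z (wbasis C j) = coeff (UP C) (root_poly A) j) \<and>
    kappa C \<ominus> qform C (wpoint d C x y z) = coeff (UP C) (root_poly A) 0" (is "?L \<longleftrightarrow> ?R")
  proof
    assume L: ?L
    have "coeff (UP C) (root_poly A) (d - 1) = x \<oplus> rn_gamma d C"
    proof -
      have "d - 1 \<noteq> d" using d_ge_3 by auto
      then show ?thesis
        using L[rule_format, of "d-1"] unfolding coeff_rn_Psi[OF xyz]
        by (simp only: if_False if_True simp_thms)
    qed
    moreover have "coeff (UP C) (root_poly A) 0 = kappa C \<ominus> qform C (wpoint d C x y z)"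
      using L[rule_format, of 0] d_ge_3 unfolding coeff_rn_Psi[OF xyz] by simp
    moreover have "coeff (UP C) (root_poly A) j = (\<one> \<oplus> \<one>) \<otimes> qinner d C z (wbasis C j)"
      if "j \<in> {1..d-2}" for j
    proof -
      have "j \<noteq> d" "j \<noteq> d - 1" using that d_ge_3 by auto
      then show ?thesis
        using L[rule_format, of j] that unfolding coeff_rn_Psi[OF xyz] by (simp only: if_False if_True)
    qed
    ultimately show ?R using sub by metis
  next
    assume R: ?R
    show ?L
    proof
      fix i
      \<comment> \<open>At \<open>d\<close> and above, the two polynomials agree automatically, both
        being monic of degree d.\<close>
      consider "i = d" | "i = d - 1" | "i \<in> {1..d-2}" | "i = 0" | "d < i"
        by fastforce
      then show "coeff (UP C) (rn_Psi d C x y z) i = coeff (UP C) (root_poly A) i"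
        unfolding coeff_rn_Psi[OF xyz] using R top above sub d_ge_3 by cases auto
    qed
  qed
  also have "x \<oplus> rn_gamma d C = \<ominus> (\<Oplus>a\<in>A. a) \<longleftrightarrow> x = \<ominus> (\<Oplus>a\<in>A. a) \<ominus> rn_gamma d C"
    using xyz S by (metis a_inv_closed add.inv_solve_right minus_eq rn_gamma_closed)
  also have "kappa C \<ominus> qform C (wpoint d C x y z) = coeff (UP C) (root_poly A) 0 \<longleftrightarrow>
      x \<otimes> y = kappa C \<ominus> coeff (UP C) (root_poly A) 0 \<ominus> qform C z"
  proof -
    have "k \<ominus> (v \<oplus> q) = c \<longleftrightarrow> v = k \<ominus> c \<ominus> q"
      if mem: "k \<in> carrier C" "v \<in> carrier C" "q \<in> carrier C" "c \<in> carrier C" for k v q c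
    proof -
      have "k \<ominus> (k \<ominus> (v \<oplus> q)) \<ominus> q = v \<oplus> (k \<oplus> \<ominus> k) \<oplus> (q \<oplus> \<ominus> q)"
        using mem by (simp only: minus_eq minus_add minus_minus a_ac a_closed a_inv_closed)
      then have "k \<ominus> (k \<ominus> (v \<oplus> q)) \<ominus> q = v"
        using mem by (simp only: r_neg r_zero)
      moreover have "k \<ominus> (k \<ominus> c \<ominus> q \<oplus> q) = c \<oplus> (k \<oplus> \<ominus> k) \<oplus> (q \<oplus> \<ominus> q)"
        using mem by (simp only: minus_eq minus_add minus_minus a_ac a_closed a_inv_closed)
      then have "k \<ominus> (k \<ominus> c \<ominus> q \<oplus> q) = c"
        using mem by (simp only: r_neg r_zero)
      ultimately show ?thesis by metis
    qed
    from this[of "kappa C" "x \<otimes> y" "qform C z" "coeff (UP C) (root_poly A) 0"]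
    show ?thesis using xyz P.coeff_closed[OF f] by (simp add: qform_wpoint)
  qed
  finally show ?thesis .
qed

text \<open>The triangular system is solved in order. Admissibility says precisely that the
  resulting x is nonzero, so the last equation can be divided by x to determine y.\<close>

lemma ex1_rn_point:
  assumes A: "A \<in> admissible d C"
  shows "\<exists>!p. \<exists>x\<in>carrier C - {\<zero>}. \<exists>y\<in>carrier C. \<exists>z\<in>wperp C.
     p = wpoint d C x y z \<and> rn_Psi d C x y z = root_poly A"
proof -
  have A': "A \<subseteq> carrier C" "\<ominus> (\<Oplus>a\<in>A. a) \<noteq> rn_gamma d C"
    using A by (auto simp: admissible_def)
  note f = P.prod_linear_closed[OF A'(1)]
  have S: "(\<Oplus>a\<in>A. a) \<in> carrier C" using A'(1) by (intro finsum_closed) auto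
  define x where "x = \<ominus> (\<Oplus>a\<in>A. a) \<ominus> rn_gamma d C"
  have x: "x \<in> carrier C" "x \<noteq> \<zero>"
    using S A'(2) by (simp_all add: x_def r_right_minus_eq)
  obtain z where z: "z \<in> wperp C"
    "\<And>j. j \<in> {1..d-2} \<Longrightarrow> (\<one> \<oplus> \<one>) \<otimes> qinner d C z (wbasis C j) = coeff (UP C) (root_poly A) j"
    using ex_wperp_qinner[of "coeff (UP C) (root_poly A)"] P.coeff_closed[OF f] by blast
  define v where "v = kappa C \<ominus> coeff (UP C) (root_poly A) 0 \<ominus> qform C z"
  have v: "v \<in> carrier C" using z P.coeff_closed[OF f] by (simp add: v_def)
  define y where "y = inv x \<otimes> v"
  have inv: "inv x \<in> carrier C" "x \<otimes> inv x = \<one>"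
    using x by (simp_all add: field_Units)
  have y: "y \<in> carrier C" "x \<otimes> y = v"
    using x v inv by (simp_all add: y_def m_assoc[symmetric])
  show ?thesis
  proof (rule ex1I[of _ "wpoint d C x y z"])
    show "\<exists>x'\<in>carrier C - {\<zero>}. \<exists>y'\<in>carrier C. \<exists>z'\<in>wperp C.
        wpoint d C x y z = wpoint d C x' y' z' \<and> rn_Psi d C x' y' z' = root_poly A"
      using x y z rn_Psi_eq_root_poly_iff[OF A x(1) y(1) z(1)] by (auto simp: x_def v_def)
  next
    fix p assume "\<exists>x'\<in>carrier C - {\<zero>}. \<exists>y'\<in>carrier C. \<exists>z'\<in>wperp C.
        p = wpoint d C x' y' z' \<and> rn_Psi d C x' y' z' = root_poly A"
    then obtain x' y' z' where p: "x' \<in> carrier C" "y' \<in> carrier C" "z' \<in> wperp C"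
        "p = wpoint d C x' y' z'" "rn_Psi d C x' y' z' = root_poly A"
      by blast
    have *: "x' = x" "\<And>j. j \<in> {1..d-2} \<Longrightarrow> (\<one> \<oplus> \<one>) \<otimes> qinner d C z' (wbasis C j) = coeff (UP C) (root_poly A) j"
        "x' \<otimes> y' = kappa C \<ominus> coeff (UP C) (root_poly A) 0 \<ominus> qform C z'"
      using p(5) unfolding rn_Psi_eq_root_poly_iff[OF A p(1-3)] by (auto simp: x_def)
    have "z' = z"
      using p(3) z(1) by (rule wperp_eqI) (use *(2) z(2) in auto)
    moreover from this have "x \<otimes> y' = x \<otimes> y"
      using * y by (simp add: v_def)
    then have "y' = y"
      using m_lcancel[of x y' y] x y(1) p(2) by blast
    ultimately show "p = wpoint d C x y z"
      using p(4) *(1) by simp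
  qed
qed

lemma rn_pointE:
  assumes "A \<in> admissible d C"
  obtains x y z where "x \<in> carrier C" "y \<in> carrier C" "z \<in> wperp C"
    "rn_point d C A = wpoint d C x y z" "rn_Psi d C x y z = root_poly A"
  using theI'[OF ex1_rn_point[OF assms]] unfolding rn_point_def by blast

lemma rn_point_closed: "A \<in> admissible d C \<Longrightarrow> rn_point d C A \<in> points d C"
  by (erule rn_pointE) simp

lemma rn_point_mem_sphere_iff:
  assumes A: "A \<in> admissible d C" and t: "t \<in> carrier C"
  shows "rn_point d C A \<in> sphere_pts d C (rn_center d C t, rn_radius d C t) \<longleftrightarrow> t \<in> A"
proof -
  obtain x y z where xyz: "x \<in> carrier C" "y \<in> carrier C" "z \<in> wperp C"
    "rn_point d C A = wpoint d C x y z" "rn_Psi d C x y z = root_poly A"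
    using A by (rule rn_pointE)
  have mem: "qform C (wpoint d C x y z \<ominus>\<^bsub>V\<^esub> rn_center d C t) \<in> carrier C"
    using xyz t by simp
  have "rn_point d C A \<in> sphere_pts d C (rn_center d C t, rn_radius d C t) \<longleftrightarrow>
      qform C (wpoint d C x y z \<ominus>\<^bsub>V\<^esub> rn_center d C t) = rn_radius d C t"
    using xyz by (simp add: sphere_pts_def)
  also have "\<dots> \<longleftrightarrow> eval C C id t (root_poly A) = \<zero>"
    unfolding xyz(5)[symmetric] eval_rn_Psi[OF xyz(1-3) t]
    using mem t by (subst r_right_minus_eq) auto
  also have "\<dots> \<longleftrightarrow> t \<in> A"
    using A t admissible_finite[OF A]
    by (intro P.eval_prod_linear_eq_zero_iff) (auto simp: admissible_def)
  finally show ?thesis .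
qed

text \<open>A set is recovered from its point as the set of labels t for which the point lies on
  S_t.\<close>

lemma inj_on_rn_point: "inj_on (rn_point d C) (admissible d C)"
proof (rule inj_onI)
  fix A B assume AB: "A \<in> admissible d C" "B \<in> admissible d C" "rn_point d C A = rn_point d C B"
  then have "A \<subseteq> carrier C" "B \<subseteq> carrier C" by (auto simp: admissible_def)
  then show "A = B"
    using rn_point_mem_sphere_iff AB by (metis subsetD subsetI subset_antisym)
qed

lemma rn_points_subset: "G \<subseteq> admissible d C \<Longrightarrow> rn_points d C G \<subseteq> points d C"
  using rn_point_closed by (auto simp: rn_points_def)

lemma card_rn_points: "G \<subseteq> admissible d C \<Longrightarrow> card (rn_points d C G) = card G"
  unfolding rn_points_def by (rule card_image) (rule inj_on_subset[OF inj_on_rn_point])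

text \<open>Incidences correspond to flags (A, t) with t in A, since both A \<mapsto> p_A and t
  \<mapsto> S_t are injective.\<close>

lemma card_incidences:
  assumes G: "G \<subseteq> admissible d C"
  shows "card {(p, s)\<in>rn_points d C G \<times> rn_spheres d C. p \<in> sphere_pts d C s} = d * card G"
proof -
  define F where "F = (\<lambda>(A, t). (rn_point d C A, (rn_center d C t, rn_radius d C t)))"
  have GC: "A \<subseteq> carrier C" if "A \<in> G" for A using that G by (auto simp: admissible_def)
  have "{(p, s)\<in>rn_points d C G \<times> rn_spheres d C. p \<in> sphere_pts d C s} = F ` (SIGMA A:G. A)"
  proof (rule equalityI; rule subsetI)
    fix ps assume "ps \<in> {(p, s)\<in>rn_points d C G \<times> rn_spheres d C. p \<in> sphere_pts d C s}"
    then obtain A t where At: "A \<in> G" "t \<in> carrier C" "ps = F (A, t)"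
        "rn_point d C A \<in> sphere_pts d C (rn_center d C t, rn_radius d C t)"
      by (auto simp: rn_points_def rn_spheres_def F_def)
    then have "t \<in> A" using rn_point_mem_sphere_iff G by blast
    with At show "ps \<in> F ` (SIGMA A:G. A)" by auto
  next
    fix ps assume "ps \<in> F ` (SIGMA A:G. A)"
    then obtain A t where At: "A \<in> G" "t \<in> A" "ps = F (A, t)" by auto
    moreover from this have "t \<in> carrier C" using GC by auto
    moreover from calculation have "rn_point d C A \<in> sphere_pts d C (rn_center d C t, rn_radius d C t)"
      using rn_point_mem_sphere_iff G by blast
    ultimately show "ps \<in> {(p, s)\<in>rn_points d C G \<times> rn_spheres d C. p \<in> sphere_pts d C s}"
      by (auto simp: rn_points_def rn_spheres_def F_def)
  qed
  moreover have "inj_on F (SIGMA A:G. A)"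
    using G GC by (auto simp: F_def inj_on_def
      dest!: inj_onD[OF inj_on_rn_point] inj_onD[OF rn_center_inj])
  ultimately have "card {(p, s)\<in>rn_points d C G \<times> rn_spheres d C. p \<in> sphere_pts d C s} =
      card (SIGMA A:G. A)"
    by (simp add: card_image)
  also have "\<dots> = (\<Sum>A\<in>G. card A)"
    using G finite_subset[OF G] admissible_finite by (intro card_SigmaI) auto
  also have "\<dots> = (\<Sum>A\<in>G. d)"
    using G by (intro sum.cong) (auto simp: admissible_def)
  finally show ?thesis by simp
qed

section \<open>The number of admissible sets\<close>

lemma card_admissible_le: "card (admissible d C) \<le> order C choose d"
proof -
  have "card (admissible d C) \<le> card {A. A \<subseteq> carrier C \<and> card A = d}"
    by (rule card_mono) (auto simp: admissible_def finite_carrier)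
  then show ?thesis by (simp add: n_subsets finite_carrier order_def)
qed

text \<open>A set with prescribed sum is determined by any $d - 1$ of its elements.\<close>

lemma card_admissible_ge: "order C choose d \<le> card (admissible d C) + (order C choose (d-1))"
proof -
  define X where "X = {A. A \<subseteq> carrier C \<and> card A = d}"
  define Y where "Y = {A. A \<subseteq> carrier C \<and> card A = d - 1}"
  define B where "B = {A \<in> X. \<ominus> (\<Oplus>a\<in>A. a) = rn_gamma d C}"
  have fin: "finite X" "finite Y" by (simp_all add: X_def Y_def finite_carrier)
  \<comment> \<open>The deleted element is an arbitrary choice. Two bad sets with the same remainder
    still delete the same element, because their sums agree.\<close>
  define h where "h A = A - {SOME a. a \<in> A}" for A :: "'a set"
  have h: "finite A \<and> A \<subseteq> carrier C \<and> (\<exists>a\<in>A. h A = A - {a})" if "A \<in> X" for A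
  proof -
    have "A \<noteq> {}" using that d_ge_3 by (auto simp: X_def)
    then have "(SOME a. a \<in> A) \<in> A" by (simp add: some_in_eq)
    then show ?thesis using that finite_subset[OF _ finite_carrier] by (auto simp: h_def X_def)
  qed
  have "inj_on h B"
  proof (rule inj_onI)
    fix A A' assume AA: "A \<in> B" "A' \<in> B" "h A = h A'"
    then have AX: "A \<in> X" "A' \<in> X" by (simp_all add: B_def)
    define W where "W = h A"
    obtain a where a: "a \<in> A" "W = A - {a}" using h[OF AX(1)] W_def by blast
    obtain a' where a': "a' \<in> A'" "W = A' - {a'}" using h[OF AX(2)] W_def AA(3) by metis
    have T: "A = insert a W" "a \<notin> W" "A' = insert a' W" "a' \<notin> W"
      using a a' by blast+
    have W: "W \<subseteq> carrier C" "finite W" "a \<in> carrier C" "a' \<in> carrier C"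
      using h[OF AX(1)] h[OF AX(2)] a(1) a'(1) unfolding a(2) by blast+
    define S where "S = (\<Oplus>b\<in>W. b)"
    have S: "S \<in> carrier C" unfolding S_def using W(1) by (intro finsum_closed) auto
    have "(\<Oplus>b\<in>A. b) = a \<oplus> S" "(\<Oplus>b\<in>A'. b) = a' \<oplus> S"
      unfolding S_def T(1) T(3) using W T(2,4) by (subst finsum_insert; auto)+
    moreover have "\<ominus> (\<Oplus>b\<in>A. b) = \<ominus> (\<Oplus>b\<in>A'. b)"
      using AA by (simp add: B_def)
    ultimately have "a = a'"
      using S W(3,4) by (metis a_closed add.right_cancel minus_minus)
    then show "A = A'" using T by simp
  qed
  moreover have "h ` B \<subseteq> Y"
  proof
    fix W assume "W \<in> h ` B"
    then obtain A where "A \<in> X" "W = h A" by (auto simp: B_def)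
    with h[of A] show "W \<in> Y" by (auto simp: X_def Y_def)
  qed
  ultimately have "card B \<le> card Y" using fin by (intro card_inj_on_le)
  moreover have "X = admissible d C \<union> B" by (auto simp: X_def B_def admissible_def)
  then have "card X \<le> card (admissible d C) + card B" by (simp add: card_Un_le)
  ultimately show ?thesis
    by (simp add: X_def Y_def n_subsets finite_carrier order_def)
qed

section \<open>The fixed-scale parameter\<close>

lemma incidence_excess_rn:
  assumes "G \<subseteq> admissible d C"
  shows "incidence_excess d C (rn_points d C G) (rn_spheres d C) = (real d - 1) * real (card G)"
  using order_pos
  unfolding incidence_excess_def card_incidences[OF assms] card_rn_points[OF assms] card_rn_spheres
  by (simp add: algebra_simps)

definition rn_param :: "'a set set \<Rightarrow> real" where
  "rn_param G = (real d - 1) * sqrt (real (card G) / real (order C) ^ d)"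

lemma rn_param_pos: "0 < card G \<Longrightarrow> 0 < rn_param G"
  using d_ge_3 order_pos by (simp add: rn_param_def)

lemma rn_param_square: "(rn_param G)\<^sup>2 = (real d - 1)\<^sup>2 * (real (card G) / real (order C) ^ d)"
  by (simp add: rn_param_def power_mult_distrib)

lemma fixed_scale_param_rn:
  assumes G: "G \<subseteq> admissible d C" "0 < card G"
  shows "fixed_scale_param d C (rn_points d C G) (rn_spheres d C) (rn_param G)"
proof -
  have q: "0 < real (order C)" using order_pos by simp
  have "real (order C) powr ((real d - 1) / 2) = sqrt (real (order C) ^ (d-1))"
    using powr_half_nat[OF q, of "d-1"] d_ge_3 by (simp add: of_nat_diff)
  then have "rn_param G * real (order C) powr ((real d - 1) / 2) * sqrt (real (card G) * real (order C))
      = (real d - 1) * sqrt (real (card G) / real (order C) ^ d *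
          (real (order C) ^ (d-1) * (real (card G) * real (order C))))"
    by (simp only: rn_param_def real_sqrt_mult mult.assoc)
  also have "real (card G) / real (order C) ^ d * (real (order C) ^ (d-1) * (real (card G) * real (order C)))
      = (real (card G))\<^sup>2"
    using q d_ge_3 by (cases d) (auto simp: power2_eq_square field_simps)
  finally show ?thesis
    using d_ge_3 G by (simp add: fixed_scale_param_def incidence_excess_rn card_rn_points card_rn_spheres)
qed

text \<open>Here K^2 q^(d-1) q = (d-1)^2 |G|, so the constant 4 is met because d - 1 \<ge> 2, with
  equality for d = 3.\<close>

lemma point_sensitive_lower_rn:
  assumes "G \<subseteq> admissible d C"
  shows "point_sensitive_lower d C (rn_points d C G) (rn_spheres d C) (rn_param G)"
proof -
  have q: "0 < real (order C)" using order_pos by simp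
  have "(rn_param G)\<^sup>2 * real (order C) ^ (d-1) * real (order C) = (real d - 1)\<^sup>2 * real (card G)"
    unfolding rn_param_square using q d_ge_3 by (cases d) (auto simp: field_simps)
  moreover have "2\<^sup>2 \<le> (real d - 1)\<^sup>2" using d_ge_3 by (intro power_mono) auto
  ultimately show ?thesis
    by (simp add: point_sensitive_lower_def card_rn_points[OF assms] card_rn_spheres mult_right_mono)
qed

text \<open>The lower end of the range is the point-sensitive condition divided by K^2 q^(d-1). The
  upper end stays a hypothesis, as it is supplied only for large q.\<close>

lemma moderate_range_rn:
  assumes G: "G \<subseteq> admissible d C" "0 < card G" and C1: "1 \<le> C1"
    and upper: "real (order C) \<le> C1 * rn_param G * real (order C) powr ((real d - 1) / 2)"
  shows "moderate_range d C C1 (rn_points d C G) (rn_spheres d C) (rn_param G)"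
  using point_sensitive_lower_rn[OF G(1)] rn_param_pos[OF G(2)] order_pos C1 upper
  by (simp add: moderate_range_def point_sensitive_lower_def card_rn_spheres divide_le_eq mult_ac)

text \<open>The density \<eta> is left free: bounding K from below works with any positive value,
  whereas the moderate range for d = 3 calls for one close to 1/3!.\<close>

lemma card_middle_hypergraph:
  assumes "middle_hypergraph d C G" and ge: "\<eta> * real (order C) ^ d \<le> real (card (admissible d C))"
  shows "\<eta> / 3 \<le> real (card G) / real (order C) ^ d" "real (card G) / real (order C) ^ d \<le> 1"
proof -
  have q: "0 < real (order C) ^ d" using order_pos by simp
  have "\<eta> / 3 * real (order C) ^ d \<le> real (card G)"
    using assms by (simp add: middle_hypergraph_def)
  then show "\<eta> / 3 \<le> real (card G) / real (order C) ^ d" using q by (simp add: pos_le_divide_eq)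
  have "real (card G) \<le> real (card (admissible d C))"
    using assms(1) by (simp add: middle_hypergraph_def)
  also have "\<dots> \<le> real (order C choose d)"
    using card_admissible_le by simp
  also have "\<dots> \<le> real (order C) ^ d"
    using binomial_le_pow[of d "order C"]
    by (cases "d \<le> order C") (auto simp: binomial_eq_0 simp flip: of_nat_power)
  finally show "real (card G) / real (order C) ^ d \<le> 1" using q by simp
qed

end

section \<open>Asymptotics\<close>

text \<open>The binomial bounds involve only q and d, so one threshold serves every
  construction.\<close>

lemma card_admissible_lower:
  assumes d: "3 \<le> d" and \<eta>: "\<eta> < 1 / fact d"
  shows "\<exists>q0. \<forall>C :: 'a rn_data. rn_construction d C \<and> q0 \<le> order C \<longrightarrow>
    \<eta> * real (order C) ^ d \<le> real (card (admissible d C))"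
proof -
  obtain k where k: "d = Suc k" using d by (cases d) auto
  have "\<forall>\<^sub>F q in sequentially. \<eta> < (real (q choose Suc k) - real (q choose k)) / real q ^ Suc k"
    by (rule order_tendstoD(1)[OF binomial_difference_tendsto]) (use \<eta> k in simp)
  then obtain q0 where q0: "\<And>q. q0 \<le> q \<Longrightarrow>
      \<eta> < (real (q choose Suc k) - real (q choose k)) / real q ^ Suc k"
    by (auto simp: eventually_sequentially)
  show ?thesis
  proof (intro exI[of _ q0] allI impI, elim conjE)
    fix C :: "'a rn_data"
    assume C: "rn_construction d C" "q0 \<le> order C"
    interpret rn_system d C using d C(1) by unfold_locales
    have "\<eta> * real (order C) ^ d < real (order C choose d) - real (order C choose (d-1))"
      using q0[OF C(2)] order_pos k by (simp add: pos_less_divide_eq del: power_Suc)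
    also have "real (order C choose d) \<le> real (card (admissible d C)) + real (order C choose (d-1))"
      using of_nat_mono[OF card_admissible_ge, where 'a=real] by simp
    finally show "\<eta> * real (order C) ^ d \<le> real (card (admissible d C))" by simp
  qed
qed

text \<open>From |G| \<ge> N/3 \<ge> \<eta>q^d/3 comes the lower constant (d-1) sqrt(\<eta>/3); from
  |G| \<le> q^d comes K \<le> d - 1, rounded up to d.\<close>

lemma rn_param_bounds:
  assumes d: "3 \<le> d"
  shows "\<exists>k1>0. \<exists>q0. \<forall>(C :: 'a rn_data) G.
    rn_construction d C \<and> q0 \<le> order C \<and> middle_hypergraph d C G \<longrightarrow>
    0 < card G \<and> k1 \<le> rn_system.rn_param d C G \<and> rn_system.rn_param d C G \<le> real d"
proof -
  \<comment> \<open>Half of the limit 1/d! of N / q^d.\<close>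
  define \<eta> :: real where "\<eta> = 1 / (2 * fact d)"
  have \<eta>: "0 < \<eta>" "\<eta> < 1 / fact d" by (simp_all add: \<eta>_def field_simps)
  obtain q0 where q0: "\<And>C :: 'a rn_data. rn_construction d C \<Longrightarrow> q0 \<le> order C \<Longrightarrow>
      \<eta> * real (order C) ^ d \<le> real (card (admissible d C))"
    using card_admissible_lower[OF d \<eta>(2), where ?'a='a] by blast
  show ?thesis
  proof (rule exI[of _ "(real d - 1) * sqrt (\<eta> / 3)"], intro conjI exI[of _ q0] allI impI; (elim conjE)?)
    show "0 < (real d - 1) * sqrt (\<eta> / 3)" using d \<eta> by simp
  next
    fix C :: "'a rn_data" and G
    assume C: "rn_construction d C" "q0 \<le> order C" "middle_hypergraph d C G"
    interpret rn_system d C using d C(1) by unfold_locales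
    note b = card_middle_hypergraph[OF C(3) q0[OF C(1,2)]]
    show "0 < card G" using b(1) \<eta>(1) by (cases "card G = 0") auto
    show "(real d - 1) * sqrt (\<eta> / 3) \<le> rn_param G"
      unfolding rn_param_def using b(1) d by (intro mult_left_mono real_sqrt_le_mono) auto
    have "rn_param G \<le> (real d - 1) * sqrt 1"
      unfolding rn_param_def using b(2) d by (intro mult_left_mono real_sqrt_le_mono) auto
    then show "rn_param G \<le> real d" by simp
  qed
qed

text \<open>The inequality amounts to C1 K q^((d-3)/2) \<ge> 1. For d \<ge> 4 the power of q
  outgrows any positive lower bound on K. For d = 3 it is absent, and the threshold 3/sqrt 2 is the
  reciprocal of the limiting lower bound for K.\<close>

lemma moderate_upper_bound:
  assumes d: "3 \<le> d" and C1: "d \<ge> 4 \<and> C1 = 1 \<or> d = 3 \<and> C1 > 3 / sqrt 2"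
  shows "\<exists>q0. \<forall>(C :: 'a rn_data) G.
    rn_construction d C \<and> q0 \<le> order C \<and> middle_hypergraph d C G \<longrightarrow>
    real (order C) \<le> C1 * rn_system.rn_param d C G * real (order C) powr ((real d - 1) / 2)"
  using C1
proof (elim disjE conjE)
  assume d4: "4 \<le> d" and C1: "C1 = 1"
  obtain k1 q0 where k1: "k1 > 0" and q0: "\<And>(C :: 'a rn_data) G. rn_construction d C \<Longrightarrow>
      q0 \<le> order C \<Longrightarrow> middle_hypergraph d C G \<Longrightarrow> k1 \<le> rn_system.rn_param d C G"
    using rn_param_bounds[OF d, where ?'a='a] by metis
  \<comment> \<open>Beyond this threshold k1 sqrt(q) \<ge> 1.\<close>
  obtain q1 :: nat where q1: "(1 / k1)\<^sup>2 < real q1" using reals_Archimedean2 by blast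
  show ?thesis
  proof (intro exI[of _ "max q0 q1"] allI impI, elim conjE)
    fix C :: "'a rn_data" and G
    assume C: "rn_construction d C" "max q0 q1 \<le> order C" "middle_hypergraph d C G"
    interpret rn_system d C using d C(1) by unfold_locales
    define q where "q = real (order C)"
    have q: "1 \<le> q" using order_pos by (simp add: q_def)
    have "(1 / k1)\<^sup>2 \<le> q" using q1 C(2) by (simp add: q_def)
    then have "1 / k1 \<le> sqrt q" using k1 by (intro real_le_rsqrt) 
    then have "1 \<le> k1 * sqrt q" using k1 by (simp add: field_simps)
    also have "\<dots> \<le> rn_param G * sqrt q"
      using q0[OF C(1) _ C(3)] C(2) q by (intro mult_right_mono) auto
    finally have "q * 1 \<le> q * (rn_param G * sqrt q)"
      using q by (intro mult_left_mono) auto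
    also have "\<dots> = rn_param G * q powr (3/2)"
    proof -
      have "q powr (3/2) = q powr (1 + 1/2)" by simp
      also have "\<dots> = q * sqrt q" unfolding powr_add using q by (simp add: powr_half_sqrt)
      finally show ?thesis by simp
    qed
    also have "\<dots> \<le> rn_param G * q powr ((real d - 1) / 2)"
      using q d4 q0[OF C(1) _ C(3)] C(2) k1 by (intro mult_left_mono powr_mono) auto
    finally show "real (order C) \<le> C1 * rn_param G * real (order C) powr ((real d - 1) / 2)"
      by (simp add: C1 q_def)
  qed
next
  assume d3: "d = 3" and C1: "C1 > 3 / sqrt 2"
  have C1_pos: "0 < C1" using C1 by (rule less_trans[rotated]) simp
  have "(3 / sqrt 2)\<^sup>2 < C1\<^sup>2" using C1 by (intro power_strict_mono) auto
  then have C1_sq: "9 / 2 < C1\<^sup>2" by (simp add: power_divide)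
  \<comment> \<open>Chosen so that 4 C1^2 \<eta> / 3 = 1, which makes C1 K \<ge> 1. The requirement
    \<eta> < 1/3! is then equivalent to C1^2 > 9/2.\<close>
  define \<eta> where "\<eta> = 3 / (4 * C1\<^sup>2)"
  have \<eta>: "\<eta> < 1 / fact d" using C1_sq C1_pos by (simp add: \<eta>_def d3 fact_numeral field_simps)
  obtain q0 where q0: "\<And>C :: 'a rn_data. rn_construction d C \<Longrightarrow> q0 \<le> order C \<Longrightarrow>
      \<eta> * real (order C) ^ d \<le> real (card (admissible d C))"
    using card_admissible_lower[OF d \<eta>, where ?'a='a] by blast
  show ?thesis
  proof (intro exI[of _ q0] allI impI, elim conjE)
    fix C :: "'a rn_data" and G
    assume C: "rn_construction d C" "q0 \<le> order C" "middle_hypergraph d C G"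
    interpret rn_system d C using d C(1) by unfold_locales
    have "\<eta> / 3 \<le> real (card G) / real (order C) ^ d"
      by (rule card_middle_hypergraph(1)[OF C(3) q0[OF C(1,2)]])
    then have "C1\<^sup>2 * (4 * (\<eta> / 3)) \<le> C1\<^sup>2 * (rn_param G)\<^sup>2"
      unfolding rn_param_square by (intro mult_left_mono) (simp_all add: d3)
    moreover have "C1\<^sup>2 * (4 * (\<eta> / 3)) = 1"
      using C1_pos by (simp add: \<eta>_def)
    ultimately have "1\<^sup>2 \<le> (C1 * rn_param G)\<^sup>2" by (simp add: power_mult_distrib)
    moreover have "0 \<le> C1 * rn_param G"
      using C1_pos d by (simp add: rn_param_def)
    ultimately have "1 \<le> C1 * rn_param G" by (rule power2_le_imp_le)
    then have "1 * real (order C) \<le> C1 * rn_param G * real (order C)"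
      by (intro mult_right_mono) auto
    then show "real (order C) \<le> C1 * rn_param G * real (order C) powr ((real d - 1) / 2)"
      by (simp add: d3)
  qed
qed

text \<open>The abstract result is applied to the set \<open>U\<close> of all points p_A.
  Injectivity gives |U| = N and makes every subset of \<open>U\<close> some P_G of the same size as
  G; templates may reach outside \<open>U\<close>.\<close>

lemma ex_far_hypergraph:
  fixes \<epsilon> :: real
  assumes d: "3 \<le> d" and \<epsilon>: "\<epsilon> < 1/2"
  shows "\<exists>\<delta>>0. \<exists>N\<^sub>0. \<forall>(C :: 'a rn_data) \<T>.
    rn_construction d C \<and> \<T> \<subseteq> Pow (points d C) \<and> N\<^sub>0 \<le> card (admissible d C) \<and>
    real (card \<T>) \<le> exp (\<delta> * real (card (admissible d C))) \<longrightarrow>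
    (\<exists>G. middle_hypergraph d C G \<and> (\<forall>T\<in>\<T>.
      \<epsilon> * real (card (admissible d C)) < real (card (sym_diff (rn_points d C G) T))))"
proof -
  obtain \<delta> N\<^sub>0 where \<delta>: "\<delta> > 0" and far: "\<And>(U :: (nat \<Rightarrow> 'a) set) \<T>.
    \<lbrakk>finite U; finite \<T>; \<forall>T\<in>\<T>. finite T; N\<^sub>0 \<le> card U; real (card \<T>) \<le> exp (\<delta> * real (card U))\<rbrakk> \<Longrightarrow>
    \<exists>G\<subseteq>U. real (card U) / 3 \<le> real (card G) \<and> real (card G) \<le> 2 * real (card U) / 3 \<and>
      (\<forall>T\<in>\<T>. \<epsilon> * real (card U) < real (card (sym_diff G T)))"
    using ex_far_middle_subset[OF \<epsilon>, where ?'b="nat \<Rightarrow> 'a"] by metis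
  show ?thesis
  proof (intro exI[of _ \<delta>] exI[of _ N\<^sub>0] conjI allI impI \<delta>, elim conjE)
    fix C :: "'a rn_data" and \<T>
    assume C: "rn_construction d C" and T: "\<T> \<subseteq> Pow (points d C)"
      and size: "N\<^sub>0 \<le> card (admissible d C)" "real (card \<T>) \<le> exp (\<delta> * real (card (admissible d C)))"
    interpret rn_system d C using d C by unfold_locales
    define U where "U = rn_points d C (admissible d C)"
    have card_U: "card U = card (admissible d C)" by (simp add: U_def card_rn_points)
    have "finite \<T>" using T by (rule finite_subset) simp
    moreover have "\<forall>T\<in>\<T>. finite T" using T by (meson Pow_iff finite_points finite_subset subsetD)
    moreover have "finite U" by (simp add: U_def rn_points_def)
    ultimately obtain W where W: "W \<subseteq> U" "real (card U) / 3 \<le> real (card W)"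
      "real (card W) \<le> 2 * real (card U) / 3" "\<forall>T\<in>\<T>. \<epsilon> * real (card U) < real (card (sym_diff W T))"
      using far[of U \<T>] size card_U by auto
    obtain G where G: "G \<subseteq> admissible d C" "W = rn_points d C G"
      using W(1) unfolding U_def rn_points_def by (rule subset_imageE)
    show "\<exists>G. middle_hypergraph d C G \<and> (\<forall>T\<in>\<T>.
        \<epsilon> * real (card (admissible d C)) < real (card (sym_diff (rn_points d C G) T)))"
      using W G card_rn_points[OF G(1)] by (intro exI[of _ G]) (simp add: middle_hypergraph_def card_U)
  qed
qed

section \<open>Sequences of constructions and their classification\<close>

lemma rn_sequence_eventually:
  assumes "rn_sequence d D"
  shows "\<forall>\<^sub>F n in sequentially. q0 \<le> order (D n)"
  using assms by (auto simp: rn_sequence_def filterlim_at_top)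

lemma card_admissible_eventually:
  fixes D :: "nat \<Rightarrow> 'a rn_data"
  assumes d: "3 \<le> d" and D: "rn_sequence d D"
  shows "\<forall>\<^sub>F n in sequentially. 1 / (2 * fact d) * real (order (D n)) ^ d \<le> real (card (admissible d (D n)))"
    and "\<forall>\<^sub>F n in sequentially. N\<^sub>0 \<le> card (admissible d (D n))"
proof -
  obtain q0 where q0: "\<And>C :: 'a rn_data. rn_construction d C \<Longrightarrow> q0 \<le> order C \<Longrightarrow>
      1 / (2 * fact d) * real (order C) ^ d \<le> real (card (admissible d C))"
    using card_admissible_lower[OF d, of "1 / (2 * fact d)", where ?'a='a] by (auto simp: field_simps)
  have D': "rn_construction d (D n)" for n using D by (simp add: rn_sequence_def)
  show *: "\<forall>\<^sub>F n in sequentially. 1 / (2 * fact d) * real (order (D n)) ^ d \<le> real (card (admissible d (D n)))"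
    using rn_sequence_eventually[OF D, of q0] by eventually_elim (rule q0[OF D'])
  show "\<forall>\<^sub>F n in sequentially. N\<^sub>0 \<le> card (admissible d (D n))"
    using * rn_sequence_eventually[OF D, of "Suc (N\<^sub>0 * (2 * fact d))"]
  proof eventually_elim
    case (elim n)
    have "real (N\<^sub>0 * (2 * fact d)) \<le> real (order (D n))"
      using elim(2) by (simp only: of_nat_le_iff Suc_leD)
    then have "real N\<^sub>0 * (2 * fact d) \<le> real (order (D n))" by simp
    \<comment> \<open>The \<open>Suc\<close> in the threshold provides q \<ge> 1 here.\<close>
    also have "\<dots> \<le> real (order (D n)) ^ d"
      using elim(2) d by (intro self_le_power) auto
    also have "\<dots> \<le> real (card (admissible d (D n))) * (2 * fact d)"
      using elim(1) by (simp add: field_simps)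
    finally show ?case by simp
  qed
qed

lemma far_hypergraphs_of_few_templates:
  fixes D :: "nat \<Rightarrow> 'a rn_data" and \<epsilon> :: real
  assumes d: "3 \<le> d" and \<epsilon>: "\<epsilon> < 1/2" and D: "rn_sequence d D" and T: "template_family d D \<T>"
    and small: "(\<lambda>n. ln (real (card (\<T> n)))) \<in> o(\<lambda>n. real (card (admissible d (D n))))"
  shows "\<forall>\<^sub>F n in sequentially. \<exists>G. middle_hypergraph d (D n) G \<and>
    (\<forall>T\<in>\<T> n. real (card (sym_diff (rn_points d (D n) G) T)) > \<epsilon> * real (card (admissible d (D n))))"
proof -
  obtain \<delta> N\<^sub>0 where \<delta>: "\<delta> > 0" and far: "\<And>(C :: 'a rn_data) \<T>.
    \<lbrakk>rn_construction d C; \<T> \<subseteq> Pow (points d C); N\<^sub>0 \<le> card (admissible d C);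
     real (card \<T>) \<le> exp (\<delta> * real (card (admissible d C)))\<rbrakk> \<Longrightarrow>
    \<exists>G. middle_hypergraph d C G \<and> (\<forall>T\<in>\<T>.
      \<epsilon> * real (card (admissible d C)) < real (card (sym_diff (rn_points d C G) T)))"
    using ex_far_hypergraph[OF d \<epsilon>, where ?'a='a] by metis
  show ?thesis
    using landau_o.smallD[OF small \<delta>] card_admissible_eventually(2)[OF d D, of N\<^sub>0]
  proof eventually_elim
    case (elim n)
    have "real (card (\<T> n)) \<le> exp (\<delta> * real (card (admissible d (D n))))"
    proof (cases "card (\<T> n) = 0")
      \<comment> \<open>Only for a positive cardinality does exp undo ln; for cardinality zero the
        bound is immediate.\<close>
      case False
      then have "ln (real (card (\<T> n))) \<le> \<delta> * real (card (admissible d (D n)))"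
        using elim(1) by simp
      then have "exp (ln (real (card (\<T> n)))) \<le> exp (\<delta> * real (card (admissible d (D n))))"
        by simp
      then show ?thesis using False by simp
    qed simp
    with elim(2) show ?case
      using D T by (intro far) (auto simp: rn_sequence_def template_family_def)
  qed
qed

text \<open>\<open>constant_K\<close> asks for containment at every index but for the bounds on K
  only eventually, hence the two separate hypotheses on \<open>G\<close>.\<close>

lemma constant_K_rn:
  fixes D :: "nat \<Rightarrow> 'a rn_data"
  assumes d: "3 \<le> d" and D: "rn_sequence d D"
    and G: "\<And>n. G n \<subseteq> admissible d (D n)" "\<forall>\<^sub>F n in sequentially. middle_hypergraph d (D n) (G n)"
  shows "constant_K d D (\<lambda>n. rn_points d (D n) (G n)) (\<lambda>n. rn_spheres d (D n))"
proof -
  obtain k1 q0 where k1: "k1 > 0" and bounds: "\<And>(C :: 'a rn_data) G. rn_construction d C \<Longrightarrow>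
      q0 \<le> order C \<Longrightarrow> middle_hypergraph d C G \<Longrightarrow>
      0 < card G \<and> k1 \<le> rn_system.rn_param d C G \<and> rn_system.rn_param d C G \<le> real d"
    using rn_param_bounds[OF d, where ?'a='a] by metis
  have sys: "rn_system d (D n)" for n
    using d D by unfold_locales (auto simp: rn_sequence_def)
  have "\<forall>\<^sub>F n in sequentially. \<exists>K. fixed_scale_param d (D n) (rn_points d (D n) (G n)) (rn_spheres d (D n)) K
      \<and> k1 \<le> K \<and> K \<le> real d"
    using G(2) rn_sequence_eventually[OF D, of q0]
  proof eventually_elim
    case (elim n)
    interpret rn_system d "D n" by (rule sys)
    show ?case
      using bounds[OF construction elim(2,1)] fixed_scale_param_rn[OF G(1)] by blast
  qed
  moreover have "rn_points d (D n) (G n) \<subseteq> points d (D n)" "rn_spheres d (D n) \<subseteq> spheres d (D n)" for n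
    using rn_system.rn_points_subset[OF sys G(1)] rn_system.rn_spheres_subset[OF sys] by auto
  ultimately show ?thesis
    unfolding constant_K_def using k1 d
    by (intro conjI allI exI[of _ k1] exI[of _ "real d"]) auto
qed

text \<open>Fixing the spheres only shrinks the class of systems to be matched, so lower bounds for
  this special case carry over to the full one.\<close>

lemma classifies_all_imp_rn:
  assumes "3 \<le> d" "rn_sequence d D" "classifies_all d D \<T>"
  shows "classifies_rn d D \<T>"
proof -
  have sub: "rn_spheres d (D n) \<subseteq> spheres d (D n)" for n
    using assms by (intro rn_system.rn_spheres_subset rn_system.intro) (auto simp: rn_sequence_def)
  show ?thesis
    unfolding classifies_rn_def classifies_def
  proof (intro allI impI)
    fix P S
    assume PS: "constant_K d D P S \<and> (\<forall>n. S n \<in> {rn_spheres d (D n)})"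
    then have "\<forall>n. S n \<in> Pow (spheres d (D n))" using sub by (simp del: PowI)
    with PS show "\<exists>\<tau>. (\<forall>\<^sub>F n in sequentially. \<tau> n \<in> \<T> n) \<and>
        (\<lambda>n. real (card (sym_diff (P n) (\<tau> n)))) \<in> o(\<lambda>n. real (order (D n)) ^ d)"
      using assms(3) unfolding classifies_all_def classifies_def by blast
  qed
qed

text \<open>Denying an eventual bound gives only infinitely many indices with few templates. A
  single sequence is built that is far from all templates at the large ones among these and merely
  of middle size at the other large ones. The templates that a classification assigns to it
  contradict the separation. The rate is \<delta>\<eta>, with \<delta> taken for the radius 1/4 and
  \<eta>q^d \<le> N for large q; neither depends on \<open>D\<close> or \<open>\<T>\<close>.\<close>

lemma card_classifying_templates:
  assumes d: "3 \<le> d"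
  shows "\<exists>c>0. \<forall>(D :: nat \<Rightarrow> 'a rn_data) \<T>.
    rn_sequence d D \<and> template_family d D \<T> \<and> classifies_rn d D \<T> \<longrightarrow>
    (\<forall>\<^sub>F n in sequentially. real (card (\<T> n)) \<ge> exp (c * real (order (D n)) ^ d))"
proof -
  obtain \<delta> N\<^sub>0 where \<delta>: "\<delta> > 0" and far: "\<And>(C :: 'a rn_data) \<T>.
    \<lbrakk>rn_construction d C; \<T> \<subseteq> Pow (points d C); N\<^sub>0 \<le> card (admissible d C);
     real (card \<T>) \<le> exp (\<delta> * real (card (admissible d C)))\<rbrakk> \<Longrightarrow>
    \<exists>G. middle_hypergraph d C G \<and> (\<forall>T\<in>\<T>.
      1/4 * real (card (admissible d C)) < real (card (sym_diff (rn_points d C G) T)))"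
    using ex_far_hypergraph[OF d, of "1/4", where ?'a='a] by (simp, metis)
  define \<eta> :: real where "\<eta> = 1 / (2 * fact d)"
  have \<eta>: "0 < \<eta>" by (simp add: \<eta>_def)
  have "\<forall>\<^sub>F n in sequentially. real (card (\<T> n)) \<ge> exp (\<delta> * \<eta> * real (order (D n)) ^ d)"
    if D: "rn_sequence d D" and T: "template_family d D \<T>" and cl: "classifies_rn d D \<T>"
    for D :: "nat \<Rightarrow> 'a rn_data" and \<T>
  proof (rule ccontr)
    assume neg: "\<not> ?thesis"
    define few where "few n \<longleftrightarrow> real (card (\<T> n)) < exp (\<delta> * \<eta> * real (order (D n)) ^ d)" for n
    \<comment> \<open>The premise \<open>few n\<close> makes \<open>P n\<close> satisfiable at every
      large index.\<close>
    define P where "P n G \<longleftrightarrow> middle_hypergraph d (D n) G \<and> (few n \<longrightarrow> (\<forall>T\<in>\<T> n.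
      1/4 * real (card (admissible d (D n))) < real (card (sym_diff (rn_points d (D n) G) T))))" for n G
    \<comment> \<open>The default \<open>{}\<close> keeps \<open>G n\<close> among the admissible
      sets at indices where no witness exists.\<close>
    define G where "G n = (if \<exists>G. P n G then SOME G. P n G else {})" for n
    note large = card_admissible_eventually[OF d D, folded \<eta>_def]
    have P: "\<forall>\<^sub>F n in sequentially. P n (G n)"
      using large(1) large(2)[of N\<^sub>0]
    proof eventually_elim
      case (elim n)
      \<comment> \<open>With many templates nothing has to be avoided, but a hypergraph of middle
        size is still required; the empty family yields it.\<close>
      define \<T>' where "\<T>' = (if few n then \<T> n else {})"
      have "exp (\<delta> * (\<eta> * real (order (D n)) ^ d)) \<le> exp (\<delta> * real (card (admissible d (D n))))"
        using elim(1) \<delta> by simp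
      moreover have "real (card \<T>') \<le> exp (\<delta> * (\<eta> * real (order (D n)) ^ d))"
        by (simp add: \<T>'_def few_def mult.assoc)
      ultimately have "real (card \<T>') \<le> exp (\<delta> * real (card (admissible d (D n))))"
        by linarith
      moreover have "\<T>' \<subseteq> Pow (points d (D n))"
        using T by (simp add: \<T>'_def template_family_def)
      ultimately obtain H where "middle_hypergraph d (D n) H \<and> (\<forall>T\<in>\<T>'.
          1/4 * real (card (admissible d (D n))) < real (card (sym_diff (rn_points d (D n) H) T)))"
        using far[of "D n" \<T>'] elim(2) D by (auto simp: rn_sequence_def)
      then have "P n H" by (simp add: P_def \<T>'_def)
      then show ?case unfolding G_def by (metis someI)
    qed
    have "G n \<subseteq> admissible d (D n)" for n
      using someI_ex[of "P n"] by (auto simp: G_def P_def middle_hypergraph_def)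
    moreover have "\<forall>\<^sub>F n in sequentially. middle_hypergraph d (D n) (G n)"
      using P by eventually_elim (simp add: P_def)
    ultimately have "constant_K d D (\<lambda>n. rn_points d (D n) (G n)) (\<lambda>n. rn_spheres d (D n))"
      by (rule constant_K_rn[OF d D])
    then obtain \<tau> where \<tau>: "\<forall>\<^sub>F n in sequentially. \<tau> n \<in> \<T> n"
      "(\<lambda>n. real (card (sym_diff (rn_points d (D n) (G n)) (\<tau> n)))) \<in> o(\<lambda>n. real (order (D n)) ^ d)"
      using cl unfolding classifies_rn_def classifies_def by blast
    \<comment> \<open>The classification puts the template within (\<eta>/4) q^d \<le> N/4 edits,
      which \<open>P\<close> excludes wherever \<open>few\<close> holds.\<close>
    have "0 < \<eta> / 4" using \<eta> by simp
    from landau_o.smallD[OF \<tau>(2) this] have "\<forall>\<^sub>F n in sequentially. \<not> few n"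
      using \<tau>(1) P large(1)
    proof eventually_elim
      case (elim n)
      show ?case
      proof
        assume "few n"
        then have "1/4 * real (card (admissible d (D n))) <
            real (card (sym_diff (rn_points d (D n) (G n)) (\<tau> n)))"
          using elim(2,3) by (simp add: P_def)
        then show False using elim(1,4) by simp
      qed
    qed
    then show False using neg by (simp add: few_def not_less)
  qed
  moreover have "0 < \<delta> * \<eta>" using \<delta> \<eta> by simp
  ultimately show ?thesis by blast
qed

lemma power_less_exp_eventually:
  fixes M :: real
  shows "\<forall>\<^sub>F y in at_top. M * y ^ k < exp y"
proof -
  have "((\<lambda>y::real. M * (y ^ k / exp y)) \<longlongrightarrow> M * 0) at_top"
    by (intro tendsto_mult tendsto_const tendsto_power_div_exp_0)
  then have "\<forall>\<^sub>F y in at_top. M * (y ^ k / exp y) < 1"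
    by (rule order_tendstoD) simp
  then show ?thesis by eventually_elim (simp add: divide_simps)
qed

text \<open>A bounded family is polynomial of degree 0, so two comparisons remain. Against a
  polynomial exp(c q) already wins, as q \<le> q^d; a subexponential family eventually has rate at
  most c/2.\<close>

lemma not_many_templates:
  fixes D :: "nat \<Rightarrow> 'a rn_data"
  assumes d: "3 \<le> d" and D: "rn_sequence d D" and c: "c > 0"
    and few: "(\<exists>B. \<forall>n. card (\<T> n) \<le> B) \<or>
         (\<exists>k. (\<lambda>n. real (card (\<T> n))) \<in> O(\<lambda>n. real (order (D n)) ^ k)) \<or>
         (\<lambda>n. ln (real (card (\<T> n)))) \<in> o(\<lambda>n. real (order (D n)) ^ d)"
  shows "\<not> (\<forall>\<^sub>F n in sequentially. real (card (\<T> n)) \<ge> exp (c * real (order (D n)) ^ d))"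
proof
  assume many: "\<forall>\<^sub>F n in sequentially. real (card (\<T> n)) \<ge> exp (c * real (order (D n)) ^ d)"
  have poly: False if O: "(\<lambda>n. real (card (\<T> n))) \<in> O(\<lambda>n. real (order (D n)) ^ k)" for k
  proof -
    obtain M where M: "M > 0" "\<forall>\<^sub>F n in sequentially. real (card (\<T> n)) \<le> M * real (order (D n)) ^ k"
      using landau_o.bigE[OF O] by auto
    \<comment> \<open>With y = c q, the polynomial M q^k becomes (M / c^k) y^k, ready for comparison
      with exp y.\<close>
    have "filterlim (\<lambda>n. c * real (order (D n))) at_top sequentially"
      using D c by (intro filterlim_tendsto_pos_mult_at_top[OF tendsto_const]
          filterlim_compose[OF filterlim_real_sequentially]) (auto simp: rn_sequence_def)
    from eventually_compose_filterlim[OF power_less_exp_eventually[of "M / c ^ k" k] this]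
    have "\<forall>\<^sub>F n in sequentially. False"
      using many M(2) rn_sequence_eventually[OF D, of 1]
    proof eventually_elim
      case (elim n)
      have "real (order (D n)) \<le> real (order (D n)) ^ d"
        using elim(4) d by (intro self_le_power) auto
      then have "exp (c * real (order (D n))) \<le> exp (c * real (order (D n)) ^ d)"
        using c by simp
      moreover have "M / c ^ k * (c * real (order (D n))) ^ k = M * real (order (D n)) ^ k"
        using c by (simp add: power_mult_distrib)
      ultimately show ?case using elim(1-3) by linarith
    qed
    then show False by simp
  qed
  have subexp: False if o: "(\<lambda>n. ln (real (card (\<T> n)))) \<in> o(\<lambda>n. real (order (D n)) ^ d)"
  proof -
    have "c / 2 > 0" using c by simp
    have "\<forall>\<^sub>F n in sequentially. False"
      using landau_o.smallD[OF o \<open>c / 2 > 0\<close>] many rn_sequence_eventually[OF D, of 1]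
    proof eventually_elim
      case (elim n)
      \<comment> \<open>The exponential lower bound forces a positive cardinality, so it may be
        passed through ln.\<close>
      have "0 < real (card (\<T> n))"
        using elim(2) by (rule less_le_trans[rotated]) simp
      then have "c * real (order (D n)) ^ d \<le> ln (real (card (\<T> n)))"
        using elim(2) by (simp add: ln_ge_iff)
      moreover have "0 < c * real (order (D n)) ^ d" using elim(3) c by simp
      ultimately show ?case using elim(1) by simp
    qed
    then show False by simp
  qed
  from few show False
  proof (elim disjE exE)
    fix B assume "\<forall>n. card (\<T> n) \<le> B"
    then have "(\<lambda>n. real (card (\<T> n))) \<in> O(\<lambda>n. real (order (D n)) ^ 0)"
      by (intro bigoI[of _ "real B"]) simp
    then show False by (rule poly)
  qed (fact poly subexp)+
qed

theorem corollary4p10: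
  fixes d :: nat
  assumes "d \<ge> 3"
  shows
    "(\<forall>(\<epsilon>::real) (D :: nat \<Rightarrow> 'a rn_data) \<T>.
        0 < \<epsilon> \<and> \<epsilon> < 1/2 \<and> rn_sequence d D \<and> template_family d D \<T> \<and>
        (\<lambda>n. ln (real (card (\<T> n)))) \<in> o(\<lambda>n. real (card (admissible d (D n)))) \<longrightarrow>
        (\<forall>\<^sub>F n in sequentially. \<exists>G. middle_hypergraph d (D n) G \<and>
           (\<forall>T\<in>\<T> n. real (card (sym_diff (rn_points d (D n) G) T))
                        > \<epsilon> * real (card (admissible d (D n)))))) \<and>
     (\<exists>k1>0. \<exists>k2>0. \<forall>C1.
        (d \<ge> 4 \<and> C1 = 1) \<or> (d = 3 \<and> C1 > 3 / sqrt 2) \<longrightarrow>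
        (\<exists>q0. \<forall>(C :: 'a rn_data) G.
           rn_construction d C \<and> order C \<ge> q0 \<and> middle_hypergraph d C G \<longrightarrow>
           (\<exists>K. fixed_scale_param d C (rn_points d C G) (rn_spheres d C) K \<and>
                k1 \<le> K \<and> K \<le> k2 \<and>
                point_sensitive_lower d C (rn_points d C G) (rn_spheres d C) K \<and>
                moderate_range d C C1 (rn_points d C G) (rn_spheres d C) K))) \<and>
     (\<exists>c>0. \<forall>(D :: nat \<Rightarrow> 'a rn_data) \<T>.
        rn_sequence d D \<and> template_family d D \<T> \<and>
        (classifies_all d D \<T> \<or> classifies_rn d D \<T>) \<longrightarrow>
        (\<forall>\<^sub>F n in sequentially. real (card (\<T> n)) \<ge> exp (c * real (order (D n)) ^ d))) \<and>
     (\<forall>(D :: nat \<Rightarrow> 'a rn_data) \<T>.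
        rn_sequence d D \<and> template_family d D \<T> \<and>
        ((\<exists>B. \<forall>n. card (\<T> n) \<le> B) \<or>
         (\<exists>k. (\<lambda>n. real (card (\<T> n))) \<in> O(\<lambda>n. real (order (D n)) ^ k)) \<or>
         (\<lambda>n. ln (real (card (\<T> n)))) \<in> o(\<lambda>n. real (order (D n)) ^ d)) \<longrightarrow>
        \<not> classifies_all d D \<T> \<and> \<not> classifies_rn d D \<T>)"
proof (intro conjI)
  show "\<forall>(\<epsilon>::real) (D :: nat \<Rightarrow> 'a rn_data) \<T>.
        0 < \<epsilon> \<and> \<epsilon> < 1/2 \<and> rn_sequence d D \<and> template_family d D \<T> \<and>
        (\<lambda>n. ln (real (card (\<T> n)))) \<in> o(\<lambda>n. real (card (admissible d (D n)))) \<longrightarrow>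
        (\<forall>\<^sub>F n in sequentially. \<exists>G. middle_hypergraph d (D n) G \<and>
           (\<forall>T\<in>\<T> n. real (card (sym_diff (rn_points d (D n) G) T))
                        > \<epsilon> * real (card (admissible d (D n)))))"
    by (intro allI impI far_hypergraphs_of_few_templates[OF assms]) blast+
next
  \<comment> \<open>These bounds are fixed before \<open>C1\<close> appears, so only the final
    threshold depends on \<open>C1\<close>.\<close>
  obtain k1 q1 where k1: "k1 > 0" and bounds: "\<And>(C :: 'a rn_data) G. rn_construction d C \<Longrightarrow>
      q1 \<le> order C \<Longrightarrow> middle_hypergraph d C G \<Longrightarrow>
      0 < card G \<and> k1 \<le> rn_system.rn_param d C G \<and> rn_system.rn_param d C G \<le> real d"
    using rn_param_bounds[OF assms, where ?'a='a] by metis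
  show "\<exists>k1>0. \<exists>k2>0. \<forall>C1.
        (d \<ge> 4 \<and> C1 = 1) \<or> (d = 3 \<and> C1 > 3 / sqrt 2) \<longrightarrow>
        (\<exists>q0. \<forall>(C :: 'a rn_data) G.
           rn_construction d C \<and> order C \<ge> q0 \<and> middle_hypergraph d C G \<longrightarrow>
           (\<exists>K. fixed_scale_param d C (rn_points d C G) (rn_spheres d C) K \<and>
                k1 \<le> K \<and> K \<le> k2 \<and>
                point_sensitive_lower d C (rn_points d C G) (rn_spheres d C) K \<and>
                moderate_range d C C1 (rn_points d C G) (rn_spheres d C) K))"
  proof (rule exI[of _ k1], intro conjI k1, rule exI[of _ "real d"], intro conjI allI impI)
    show "0 < real d" using assms by simp
    fix C1 assume C1: "(d \<ge> 4 \<and> C1 = 1) \<or> (d = 3 \<and> C1 > 3 / sqrt 2)"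
    \<comment> \<open>The moderate range demands C1 \<ge> 1, which for d = 3 follows from 3/sqrt 2
      \<ge> 1.\<close>
    have "sqrt 2 \<le> sqrt (3\<^sup>2)" by (intro real_sqrt_le_mono) simp
    then have "1 \<le> 3 / sqrt 2" by simp
    then have C1_ge: "1 \<le> C1" using C1 by linarith
    obtain q2 where q2: "\<And>(C :: 'a rn_data) G. rn_construction d C \<Longrightarrow> q2 \<le> order C \<Longrightarrow>
        middle_hypergraph d C G \<Longrightarrow>
        real (order C) \<le> C1 * rn_system.rn_param d C G * real (order C) powr ((real d - 1) / 2)"
      using moderate_upper_bound[OF assms C1, where ?'a='a] by metis
    show "\<exists>q0. \<forall>(C :: 'a rn_data) G.
           rn_construction d C \<and> order C \<ge> q0 \<and> middle_hypergraph d C G \<longrightarrow>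
           (\<exists>K. fixed_scale_param d C (rn_points d C G) (rn_spheres d C) K \<and>
                k1 \<le> K \<and> K \<le> real d \<and>
                point_sensitive_lower d C (rn_points d C G) (rn_spheres d C) K \<and>
                moderate_range d C C1 (rn_points d C G) (rn_spheres d C) K)"
    proof (intro exI[of _ "max q1 q2"] allI impI, elim conjE)
      fix C :: "'a rn_data" and G
      assume C: "rn_construction d C" "max q1 q2 \<le> order C" and G: "middle_hypergraph d C G"
      interpret rn_system d C using assms C(1) by unfold_locales
      have adm: "G \<subseteq> admissible d C" using G by (simp add: middle_hypergraph_def)
      have b: "0 < card G" "k1 \<le> rn_param G" "rn_param G \<le> real d"
        using bounds[OF C(1) _ G] C(2) by auto
      have "real (order C) \<le> C1 * rn_param G * real (order C) powr ((real d - 1) / 2)"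
        using q2[OF C(1) _ G] C(2) by simp
      then show "\<exists>K. fixed_scale_param d C (rn_points d C G) (rn_spheres d C) K \<and>
                k1 \<le> K \<and> K \<le> real d \<and>
                point_sensitive_lower d C (rn_points d C G) (rn_spheres d C) K \<and>
                moderate_range d C C1 (rn_points d C G) (rn_spheres d C) K"
        using fixed_scale_param_rn[OF adm b(1)] point_sensitive_lower_rn[OF adm]
          moderate_range_rn[OF adm b(1) C1_ge] b(2,3) by blast
    qed
  qed
next
  show "\<exists>c>0. \<forall>(D :: nat \<Rightarrow> 'a rn_data) \<T>.
        rn_sequence d D \<and> template_family d D \<T> \<and>
        (classifies_all d D \<T> \<or> classifies_rn d D \<T>) \<longrightarrow>
        (\<forall>\<^sub>F n in sequentially. real (card (\<T> n)) \<ge> exp (c * real (order (D n)) ^ d))"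
    using card_classifying_templates[OF assms, where ?'a='a] classifies_all_imp_rn[OF assms] by metis
next
  obtain c where c: "c > 0" and many: "\<And>(D :: nat \<Rightarrow> 'a rn_data) \<T>.
      \<lbrakk>rn_sequence d D; template_family d D \<T>; classifies_rn d D \<T>\<rbrakk> \<Longrightarrow>
      \<forall>\<^sub>F n in sequentially. real (card (\<T> n)) \<ge> exp (c * real (order (D n)) ^ d)"
    using card_classifying_templates[OF assms, where ?'a='a] by metis
  show "\<forall>(D :: nat \<Rightarrow> 'a rn_data) \<T>.
        rn_sequence d D \<and> template_family d D \<T> \<and>
        ((\<exists>B. \<forall>n. card (\<T> n) \<le> B) \<or>
         (\<exists>k. (\<lambda>n. real (card (\<T> n))) \<in> O(\<lambda>n. real (order (D n)) ^ k)) \<or>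
         (\<lambda>n. ln (real (card (\<T> n)))) \<in> o(\<lambda>n. real (order (D n)) ^ d)) \<longrightarrow>
        \<not> classifies_all d D \<T> \<and> \<not> classifies_rn d D \<T>"
  proof (intro allI impI, elim conjE)
    fix D :: "nat \<Rightarrow> 'a rn_data" and \<T>
    assume D: "rn_sequence d D" and T: "template_family d D \<T>"
      and few: "(\<exists>B. \<forall>n. card (\<T> n) \<le> B) \<or>
         (\<exists>k. (\<lambda>n. real (card (\<T> n))) \<in> O(\<lambda>n. real (order (D n)) ^ k)) \<or>
         (\<lambda>n. ln (real (card (\<T> n)))) \<in> o(\<lambda>n. real (order (D n)) ^ d)"
    \<comment> \<open>Refuting the case of fixed spheres is enough, since a full classification
      would restrict to it.\<close>
    have "\<not> classifies_rn d D \<T>"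
      using not_many_templates[OF assms D c few] many[OF D T] by blast
    then show "\<not> classifies_all d D \<T> \<and> \<not> classifies_rn d D \<T>"
      using classifies_all_imp_rn[OF assms D] by blast
  qed
qed

end
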